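(* Let $K=1/9$. Let $\beta_n\in A_n$ for every $n$, with $n\varepsilon_{n,\beta_n}^2\to\infty$ as $n\to\infty$. Assume there exist positive constants $B$, $E_\alpha$ (indexed by the model indices $\alpha$), $L$, $H\ge 1$, $I>2$, and constants $\mu_{n,\alpha}$ ($\alpha\in A_n$), such that, with $\alpha\gtrsim\beta_n$ and $\alpha<\beta_n$ defined relative to $H$, the following hold: (i) $\displaystyle \sup_{\varepsilon\ge\varepsilon_{n,\alpha}}\log N\Big(\frac{\varepsilon}{3},C_{n,\alpha}(2\varepsilon),d\Big)\le E_\alpha n\varepsilon_{n,\alpha}^2$ for all $\alpha\in A_n$; (ii) $\displaystyle \frac{\lambda_{n,\alpha}}{\lambda_{n,\beta_n}}\frac{\Pi_{n,\alpha}(C_{n,\alpha}(i\varepsilon_{n,\alpha}))}{\Pi_{n,\beta_n}(B_{n,\beta_n}(\varepsilon_{n,\beta_n}))}\le\mu_{n,\alpha}e^{Li^2n\varepsilon_{n,\alpha}^2}$ for all $\alpha<\beta_n$ and all $i\ge I$; (iii) $\displaystyle \frac{\lambda_{n,\alpha}}{\lambda_{n,\beta_n}}\frac{\Pi_{n,\alpha}(C_{n,\alpha}(i\varepsilon_{n,\beta_n}))}{\Pi_{n,\beta_n}(B_{n,\beta_n}(\varepsilon_{n,\beta_n}))}\le\mu_{n,\alpha}e^{Li^2n\varepsilon_{n,\beta_n}^2}$ for all $\alpha\gtrsim\beta_n$ and all $i\ge I$; (iv) $\displaystyle \sum_{\alpha\in A_n:\alpha<\beta_n}\frac{\lambda_{n,\alpha}}{\lambda_{n,\beta_n}}\frac{\Pi_{n,\alpha}(C_{n,\alpha}(IB\varepsilon_{n,\alpha}))}{\Pi_{n,\beta_n}(B_{n,\beta_n}(\varepsilon_{n,\beta_n}))}=o\big(e^{-2n\varepsilon_{n,\beta_n}^2}\big)$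 as $n\to\infty$; and constants $E$ and $\underline E$ such that $E\ge\sup_{\alpha\in A_n:\alpha\gtrsim\beta_n}E_\alpha\varepsilon_{n,\alpha}^2/\varepsilon_{n,\beta_n}^2$ and $\underline E\ge\sup_{\alpha\in A_n:\alpha<\beta_n}E_\alpha$ (with $\underline E=0$ if there is no $\alpha\in A_n$ with $\alpha<\beta_n$), and $$B>\sqrt H,\qquad KB^2>\big((H\underline E)\vee E\big)+1,\qquad B^2I^2(K-2L)>3.$$ Assume furthermore that $\sum_{\alpha\in A_n}\sqrt{\mu_{n,\alpha}}\le\exp[n\varepsilon_{n,\beta_n}^2]$. Then $$P_0^n\,\Pi_n\big(p:d(p,p_0)\ge IB\,\varepsilon_{n,\beta_n}\,\big|\,X_1,\dots,X_n\big)\to0\qquad(n\to\infty).$$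
   Context: Setting. $X_1,\dots,X_n$ is an i.i.d. sample from a probability measure $P_0$ on a measurable space $(\mathcal X,\mathcal A)$ with density $p_0$ relative to a reference measure $\mu$. In general $p$ and $P$ denote a density and the corresponding probability measure; $Pf=\int f\,dP$, and $P_0^n T$ denotes the expectation of $T(X_1,\dots,X_n)$ under $P_0^n$. The Hellinger distance is $h(p,q)=\|\sqrt p-\sqrt q\|_2$ (norm of $L_2(\mu)$). $d$ is a metric on the set of probability densities that is bounded above by $h$ and whose balls are convex. $N(\varepsilon,\mathcal P,d)$ is the $\varepsilon$-covering number of the metric space $(\mathcal P,d)$: the minimal number of balls of radius $\varepsilon$ needed to cover $\mathcal P$. For each $n$: $A_n$ is a countable set; for each $\alpha\in A_n$, $\mathcal P_{n,\alpha}$ is a set of $\mu$-probability densities with a $\sigma$-field making $(x,p)\mapsto p(x)$ measurable, $\Pi_{n,\alpha}$ is a probability measure on $\mathcal P_{n,\alpha}$; and $\lambda_n=(\lambda_{n,\alpha}:\alpha\in A_n)$ is a probability measure on $A_n$. The prior is $\Pi_n=\sum_{\alpha\in A_n}\lambda_{n,\alpha}\Pi_{n,\alpha}$ and the posterior is $$\Pi_n(S|X_1,\dots,X_n)=\frac{\sum_{\alpha\in A_n}\lambda_{n,\alpha}\int_{p\in\mathcal P_{n,\alpha}:p\in S}\prod_{i=1}^np(X_i)\,d\Pi_{n,\alpha}(p)}{\sum_{\alpha\in A_n}\lambda_{n,\alpha}\int_{\mathcal P_{n,\alpha}}\prod_{i=1}^np(X_i)\,d\Pi_{n,\alpha}(p)},$$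 with appropriate measurability assumed so that this is well defined. Neighbourhoods: $$B_{n,\alpha}(\varepsilon)=\Big\{p\in\mathcal P_{n,\alpha}:-P_0\log\frac p{p_0}\le\varepsilon^2,\ P_0\Big(\log\frac p{p_0}\Big)^2\le\varepsilon^2\Big\},\quad C_{n,\alpha}(\varepsilon)=\{p\in\mathcal P_{n,\alpha}:d(p,p_0)\le\varepsilon\}.$$ $\varepsilon_{n,\alpha}>0$ are given numbers with $\varepsilon_{n,\alpha}\to0$ as $n\to\infty$. For given $\beta_n\in A_n$ and a constant $H\ge1$, and $\alpha\in A_n$: $\alpha\gtrsim\beta_n$ means $\varepsilon_{n,\alpha}^2\le H\varepsilon_{n,\beta_n}^2$, and $\alpha<\beta_n$ means $\varepsilon_{n,\alpha}^2>H\varepsilon_{n,\beta_n}^2$ (no order on $A_n$ is assumed). Conditions involving $\alpha<\beta_n$ are understood to be automatically satisfied if there is no such $\alpha$. *)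

theory Defs
  imports
    "HOL-Probability.Probability"
    "HOL-Library.Landau_Symbols"
    "HOL-Library.Extended_Nat"
begin

text \<open>
  \<open>M\<close> is the reference measure on the sample space. Densities are genuine (pointwise nonnegative,
  real-valued) functions, not classes modulo equality almost everywhere.
\<close>

definition densities :: "'x measure \<Rightarrow> ('x \<Rightarrow> real) set" where
  "densities M =
     {p \<in> borel_measurable M. (\<forall>x\<in>space M. 0 \<le> p x) \<and> (\<integral>\<^sup>+ x. ennreal (p x) \<partial>M) = 1}"

definition law :: "'x measure \<Rightarrow> ('x \<Rightarrow> real) \<Rightarrow> 'x measure" where
  "law M p = density M (\<lambda>x. ennreal (p x))"

definition hellinger :: "'x measure \<Rightarrow> ('x \<Rightarrow> real) \<Rightarrow> ('x \<Rightarrow> real) \<Rightarrow> real" where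
  "hellinger M p q = sqrt (\<integral>x. (sqrt (p x) - sqrt (q x))\<^sup>2 \<partial>M)"

text \<open>
  A metric on the set of probability densities. As usual, densities that agree \<open>M\<close>-almost
  everywhere are identified; since densities are represented by functions, definiteness is stated
  modulo this identification. (No \<open>d\<close> bounded by the Hellinger distance could separate
  two different versions of the same density.)
\<close>

definition density_metric ::
    "'x measure \<Rightarrow> (('x \<Rightarrow> real) \<Rightarrow> ('x \<Rightarrow> real) \<Rightarrow> real) \<Rightarrow> bool" where
  "density_metric M d \<longleftrightarrow>
     (\<forall>p\<in>densities M. \<forall>q\<in>densities M.
        0 \<le> d p q \<and> d p q = d q p \<and> (d p q = 0 \<longleftrightarrow> (AE x in M. p x = q x))) \<and>
     (\<forall>p\<in>densities M. \<forall>q\<in>densities M. \<forall>r\<in>densities M. d p r \<le> d p q + d q r)"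

definition density_ball ::
    "'x measure \<Rightarrow> (('x \<Rightarrow> real) \<Rightarrow> ('x \<Rightarrow> real) \<Rightarrow> real) \<Rightarrow> ('x \<Rightarrow> real) \<Rightarrow> real \<Rightarrow> ('x \<Rightarrow> real) set"
  where "density_ball M d p r = {q \<in> densities M. d p q < r}"

text \<open>
  Convexity is written out because functions are not an instance of \<open>real_vector\<close>. Asking for
  convexity of all open balls is equivalent to asking for it for all closed balls.
\<close>

definition convex_balls ::
    "'x measure \<Rightarrow> (('x \<Rightarrow> real) \<Rightarrow> ('x \<Rightarrow> real) \<Rightarrow> real) \<Rightarrow> bool" where
  "convex_balls M d \<longleftrightarrow>
     (\<forall>p\<in>densities M. \<forall>r::real. \<forall>q1\<in>density_ball M d p r. \<forall>q2\<in>density_ball M d p r.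
        \<forall>t\<in>{0..1}. (\<lambda>x. (1 - t) * q1 x + t * q2 x) \<in> density_ball M d p r)"

text \<open>
  Covering number of \<open>S\<close> regarded as a metric space of its own, so the centres lie in \<open>S\<close>;
  it is \<open>\<infinity>\<close> if no finite cover exists.
\<close>

definition covering_number :: "real \<Rightarrow> 'p set \<Rightarrow> ('p \<Rightarrow> 'p \<Rightarrow> real) \<Rightarrow> enat" where
  "covering_number \<epsilon> S d =
     (INF F \<in> {F. finite F \<and> F \<subseteq> S \<and> S \<subseteq> (\<Union>c\<in>F. {q \<in> S. d c q < \<epsilon>})}. enat (card F))"

definition log_enat :: "enat \<Rightarrow> ereal" where
  "log_enat N = (case N of enat k \<Rightarrow> (if k = 0 then -\<infinity> else ereal (ln (real k))) | \<infinity> \<Rightarrow> \<infinity>)"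

text \<open>
  \<open>KL_nbhd\<close> and \<open>dist_nbhd\<close> are the neighbourhoods B and C in a model \<open>P\<close>. Here
  \<open>log (p / p0)\<close> is \<open>-\<infinity>\<close> where \<open>p\<close> vanishes, whereas HOL has \<open>ln 0 = 0\<close>; the first two conjuncts
  of \<open>KL_nbhd\<close> say that the integral of the squared logarithm is finite with the correct convention.
  The logarithm itself is then integrable too, the law of \<open>p0\<close> being a probability measure.
\<close>

definition KL_nbhd ::
    "'x measure \<Rightarrow> ('x \<Rightarrow> real) \<Rightarrow> ('x \<Rightarrow> real) set \<Rightarrow> real \<Rightarrow> ('x \<Rightarrow> real) set" where
  "KL_nbhd M p0 P \<epsilon> =
     {p \<in> P. (AE x in law M p0. 0 < p x) \<and>
             integrable (law M p0) (\<lambda>x. (ln (p x / p0 x))\<^sup>2) \<and>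
             - (\<integral>x. ln (p x / p0 x) \<partial>law M p0) \<le> \<epsilon>\<^sup>2 \<and>
             (\<integral>x. (ln (p x / p0 x))\<^sup>2 \<partial>law M p0) \<le> \<epsilon>\<^sup>2}"

definition dist_nbhd ::
    "(('x \<Rightarrow> real) \<Rightarrow> ('x \<Rightarrow> real) \<Rightarrow> real) \<Rightarrow> ('x \<Rightarrow> real) \<Rightarrow> ('x \<Rightarrow> real) set \<Rightarrow> real \<Rightarrow> ('x \<Rightarrow> real) set"
  where "dist_nbhd d p0 P \<epsilon> = {p \<in> P. d p p0 \<le> \<epsilon>}"

text \<open>
  A model with index \<open>\<alpha>\<close> and its prior are given together by a measure \<open>\<pi> \<alpha>\<close> on functions; the model
  is \<open>space (\<pi> \<alpha>)\<close>. The last conjunct is joint measurability of \<open>(x, p) \<mapsto> p x\<close>.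
\<close>

definition model_prior :: "'x measure \<Rightarrow> ('x \<Rightarrow> real) measure \<Rightarrow> bool" where
  "model_prior M \<pi> \<longleftrightarrow>
     prob_space \<pi> \<and> space \<pi> \<subseteq> densities M \<and>
     (\<lambda>(x, p). p x) \<in> borel_measurable (M \<Otimes>\<^sub>M \<pi>)"

text \<open>\<open>\<alpha> < \<beta>\<close> respectively \<open>\<alpha> \<greatersim> \<beta>\<close>, for the rates \<open>e\<close> at a fixed sample size.\<close>

definition coarser_models :: "real \<Rightarrow> 'i set \<Rightarrow> ('i \<Rightarrow> real) \<Rightarrow> 'i \<Rightarrow> 'i set" where
  "coarser_models H A e \<beta> = {\<alpha> \<in> A. (e \<alpha>)\<^sup>2 > H * (e \<beta>)\<^sup>2}"

definition finer_models :: "real \<Rightarrow> 'i set \<Rightarrow> ('i \<Rightarrow> real) \<Rightarrow> 'i \<Rightarrow> 'i set" where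
  "finer_models H A e \<beta> = {\<alpha> \<in> A. (e \<alpha>)\<^sup>2 \<le> H * (e \<beta>)\<^sup>2}"

definition weighted_likelihood ::
    "'i set \<Rightarrow> ('i \<Rightarrow> real) \<Rightarrow> ('i \<Rightarrow> ('x \<Rightarrow> real) measure) \<Rightarrow> nat \<Rightarrow> ('x \<Rightarrow> real) set \<Rightarrow> (nat \<Rightarrow> 'x) \<Rightarrow> ennreal"
  where
  "weighted_likelihood A w \<pi> n S X =
     (\<Sum>\<^sub>\<infinity>\<alpha>\<in>A. ennreal (w \<alpha>) * (\<integral>\<^sup>+ p\<in>S. ennreal (\<Prod>i<n. p (X i)) \<partial>\<pi> \<alpha>))"

text \<open>
  Posterior mass of \<open>S\<close>, with observations \<open>X 0, \<dots>, X (n - 1)\<close>. It is \<open>0\<close> on the event that the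
  denominator is \<open>0\<close> or \<open>\<infinity>\<close>.
\<close>

definition posterior ::
    "'i set \<Rightarrow> ('i \<Rightarrow> real) \<Rightarrow> ('i \<Rightarrow> ('x \<Rightarrow> real) measure) \<Rightarrow> nat \<Rightarrow> ('x \<Rightarrow> real) set \<Rightarrow> (nat \<Rightarrow> 'x) \<Rightarrow> ennreal"
  where
  "posterior A w \<pi> n S X =
     weighted_likelihood A w \<pi> n S X / weighted_likelihood A w \<pi> n UNIV X"

definition sample_law :: "'x measure \<Rightarrow> ('x \<Rightarrow> real) \<Rightarrow> nat \<Rightarrow> (nat \<Rightarrow> 'x) measure" where
  "sample_law M p0 n = (\<Pi>\<^sub>M i\<in>{..<n}. law M p0)"

end

theory Submission
  imports Defs
begin

text \<open>
  A posterior mass is at most one, hence at most its square root. So no tests are needed: it suffices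
  to bound the expectation of \<open>sqrt (\<integral> \<Prod>i. p (X i) / p0 (X i))\<close> over pieces of the models, and on
  a convex set of densities at Hellinger distance at least \<open>\<delta>\<close> from \<open>p0\<close> the affinity of a mixture
  of products tensorizes to at most \<open>exp (- n \<delta>\<^sup>2 / 2)\<close>. Every model is cut into thin shells around
  \<open>p0\<close>, each shell is covered by balls in number given by the entropy, and the denominator of the
  posterior is bounded below by Chebyshev's inequality on the Kullback-Leibler neighbourhood of the
  model \<open>\<beta> n\<close>. The square root turns the prior mass ratios into the weights \<open>sqrt (\<mu> n \<alpha>)\<close>.
\<close>

section \<open>Mixtures and empirical approximation\<close>

text \<open>Why affinities tensorize: with the first \<open>n\<close> observations fixed, a mixture
  of products is, as a function of the next one, a mixture of the same densities with new weights.
  Normalised, it lies in the convex ball again, so every observation contributes the same factor,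
  whatever the weights; this is why the weights are left unnormalised. The obstacle is that
  convexity speaks of finite combinations only, while a prior is an arbitrary measure. Hence
  mixtures are replaced by empirical ones, close in mean square.

  Exponent budget, with \<open>a = n e\<^sup>2\<close> and \<open>e\<close> the rate of
  \<open>\<beta> n\<close>: the evidence may lose \<open>exp (- 2 * a)\<close>, which costs
  \<open>exp a\<close> under the square root, and the sum of \<open>sqrt (\<mu> n \<alpha>)\<close>
  costs another \<open>exp a\<close>. Shell bounds of order \<open>exp (- 3 * a)\<close> therefore
  leave \<open>exp (- a)\<close>. The one region treated without a square root is the central part
  of a coarse model, where only its small prior mass helps; it pays the full
  \<open>exp (2 * a)\<close>, which is the order in the small-o condition.\<close>

lemma exists_le_average:
  fixes \<phi> :: "'b \<Rightarrow> real"
  assumes "prob_space N" "integrable N \<phi>" "(\<integral>p. \<phi> p \<partial>N) \<le> c" "AE p in N. p \<in> S"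
  shows "\<exists>p\<in>S \<inter> space N. \<phi> p \<le> c"
proof (rule ccontr)
  interpret prob_space N by fact
  assume "\<not> ?thesis"
  then have "AE p in N. p \<in> S \<longrightarrow> c < \<phi> p" by (auto simp: not_le)
  with assms(4) have *: "AE p in N. c < \<phi> p" by (rule AE_mp)
  have "expectation \<phi> > c"
    using assms(2) * by (rule expectation_greater)
  then show False using assms(3) by simp
qed

text \<open>
  Maurey's empirical method with a greedy choice of the sample points: in each step the cross term
  averages to zero, so some point does not increase the error by more than the average.
\<close>

lemma empirical_approximation:
  fixes f :: "'a \<Rightarrow> 'b \<Rightarrow> real"
  assumes Q: "prob_space Q" and N: "prob_space N"
    and f[measurable]: "(\<lambda>(x, p). f x p) \<in> borel_measurable (Q \<Otimes>\<^sub>M N)"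
    and bnd: "\<And>x p. x \<in> space Q \<Longrightarrow> p \<in> space N \<Longrightarrow> 0 \<le> f x p \<and> f x p \<le> T"
    and S: "AE p in N. p \<in> S"
  shows "\<exists>ps. (\<forall>k<m. ps k \<in> S \<inter> space N) \<and>
    (\<integral>x. (\<Sum>k<m. f x (ps k) - (\<integral>p. f x p \<partial>N))\<^sup>2 \<partial>Q) \<le> real m * T\<^sup>2"
proof (induction m)
  case 0
  then show ?case by simp
next
  case (Suc m)
  interpret Q: prob_space Q by fact
  interpret N: prob_space N by fact
  interpret QN: pair_prob_space Q N ..
  define fb where "fb x = (\<integral>p. f x p \<partial>N)" for x
  have fb_m[measurable]: "fb \<in> borel_measurable Q"
    unfolding fb_def by measurable
  obtain ps where ps: "\<forall>k<m. ps k \<in> S \<inter> space N"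
    and IH: "(\<integral>x. (\<Sum>k<m. f x (ps k) - fb x)\<^sup>2 \<partial>Q) \<le> real m * T\<^sup>2"
    using Suc.IH unfolding fb_def by blast
  define g where "g x = (\<Sum>k<m. f x (ps k) - fb x)" for x
  have [measurable]: "(\<lambda>x. f x p) \<in> borel_measurable Q" if "p \<in> space N" for p
    using measurable_Pair1[OF f that] by simp
  have [measurable]: "(\<lambda>p. f x p) \<in> borel_measurable N" if "x \<in> space Q" for x
    using measurable_Pair2[OF f that] by simp
  have g_m[measurable]: "g \<in> borel_measurable Q"
    unfolding g_def using ps by (intro borel_measurable_sum borel_measurable_diff) auto
  have int_f: "integrable N (f x)" if "x \<in> space Q" for x
    using that bnd by (intro N.integrable_const_bound[where B=T] AE_I2) auto
  have fb_bnd: "0 \<le> fb x \<and> fb x \<le> T" if "x \<in> space Q" for x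
    unfolding fb_def using that bnd int_f[OF that]
    by (auto intro!: integral_nonneg_AE AE_I2 N.integral_le_const)
  have df: "\<bar>f x p - fb x\<bar> \<le> T" if "x \<in> space Q" "p \<in> space N" for x p
    using bnd[OF that] fb_bnd[OF that(1)] by auto
  have T: "0 \<le> T"
    using Q.not_empty N.not_empty bnd by fastforce
  have g_bnd: "\<bar>g x\<bar> \<le> real m * T" if "x \<in> space Q" for x
  proof -
    have "\<bar>g x\<bar> \<le> (\<Sum>k<m. \<bar>f x (ps k) - fb x\<bar>)" unfolding g_def by (rule sum_abs)
    also have "\<dots> \<le> (\<Sum>k<m. T)" using ps df that by (intro sum_mono) auto
    finally show ?thesis by simp
  qed
  have sq_bnd: "(g x + (f x p - fb x))\<^sup>2 \<le> (real m * T + T)\<^sup>2" if "x \<in> space Q" "p \<in> space N" for x p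
    using g_bnd[OF that(1)] df[OF that] T by (intro power2_le_iff_abs_le[THEN iffD2]) auto
  have int2: "integrable (Q \<Otimes>\<^sub>M N) (\<lambda>(x, p). (g x + (f x p - fb x))\<^sup>2)"
    by (rule QN.integrable_const_bound[where B="(real m * T + T)\<^sup>2"])
      (use sq_bnd in \<open>auto intro!: AE_I2 simp: space_pair_measure\<close>)
  have inner: "(\<integral>p. (g x + (f x p - fb x))\<^sup>2 \<partial>N) \<le> (g x)\<^sup>2 + T\<^sup>2" if x: "x \<in> space Q" for x
  proof -
    have i1: "integrable N (\<lambda>p. f x p - fb x)" using int_f[OF x] by simp
    have i2: "integrable N (\<lambda>p. (f x p - fb x)\<^sup>2)"
      using df[OF x] x T by (intro N.integrable_const_bound[where B="T\<^sup>2"] AE_I2) (auto simp: abs_le_square_iff[symmetric])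
    have "(\<integral>p. (g x + (f x p - fb x))\<^sup>2 \<partial>N)
        = (\<integral>p. (g x)\<^sup>2 + 2 * g x * (f x p - fb x) + (f x p - fb x)\<^sup>2 \<partial>N)"
      by (simp add: power2_eq_square algebra_simps)
    also have "\<dots> = (g x)\<^sup>2 + 2 * g x * (\<integral>p. f x p - fb x \<partial>N) + (\<integral>p. (f x p - fb x)\<^sup>2 \<partial>N)"
      using i1 i2 by (simp add: N.prob_space)
    also have "(\<integral>p. f x p - fb x \<partial>N) = 0"
      using int_f[OF x] by (simp add: N.prob_space fb_def)
    also have "(\<integral>p. (f x p - fb x)\<^sup>2 \<partial>N) \<le> T\<^sup>2"
      using i2 df[OF x] T by (intro N.integral_le_const AE_I2) (auto simp: abs_le_square_iff[symmetric])
    finally show ?thesis by simp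
  qed
  have int_g2: "integrable Q (\<lambda>x. (g x)\<^sup>2)"
    using g_bnd T by (intro Q.integrable_const_bound[where B="(real m * T)\<^sup>2"] AE_I2)
      (auto simp: abs_le_square_iff[symmetric] abs_mult)
  \<comment> \<open>This is the error as a function of the new sample point. \<open>inner\<close>
    and Fubini bound its average, so some point of \<open>S\<close> does at least as well.\<close>
  define \<phi> where "\<phi> p = (\<integral>x. (g x + (f x p - fb x))\<^sup>2 \<partial>Q)" for p
  have "(\<integral>p. \<phi> p \<partial>N) = (\<integral>x. (\<integral>p. (g x + (f x p - fb x))\<^sup>2 \<partial>N) \<partial>Q)"
    unfolding \<phi>_def using int2 by (rule QN.Fubini_integral)
  also have "\<dots> \<le> (\<integral>x. (g x)\<^sup>2 + T\<^sup>2 \<partial>Q)"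
    using int_g2 inner QN.integrable_fst[OF int2] by (intro integral_mono) auto
  also have "\<dots> \<le> real (Suc m) * T\<^sup>2"
    using int_g2 IH by (simp add: g_def Q.prob_space algebra_simps)
  finally have "(\<integral>p. \<phi> p \<partial>N) \<le> real (Suc m) * T\<^sup>2" .
  moreover have "integrable N \<phi>"
    unfolding \<phi>_def using QN.integrable_snd[OF int2] .
  ultimately obtain p where p: "p \<in> S \<inter> space N" "\<phi> p \<le> real (Suc m) * T\<^sup>2"
    using exists_le_average[OF N _ _ S] by blast
  show ?case
  proof (intro exI[of _ "ps(m := p)"] conjI)
    show "\<forall>k<Suc m. (ps(m := p)) k \<in> S \<inter> space N"
      using ps p by (auto simp: less_Suc_eq)
    have "(\<Sum>k<m. f x ((ps(m := p)) k) - fb x) = g x" for x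
      unfolding g_def by (intro sum.cong) auto
    then show "(\<integral>x. (\<Sum>k<Suc m. f x ((ps(m := p)) k) - (\<integral>p. f x p \<partial>N))\<^sup>2 \<partial>Q) \<le> real (Suc m) * T\<^sup>2"
      using p(2) unfolding \<phi>_def fb_def[symmetric] by simp
  qed
qed

text \<open>The square root is not Lipschitz at 0, so it is majorised by a small constant plus a
  quadratic; this turns a mean square error into an error of the square root. Below
  \<open>\<eta>\<^sup>2\<close> the constant suffices; above it,
  \<open>s = sqrt \<bar>y\<bar>\<close> satisfies
  \<open>\<eta> ^ 3 * s \<le> s ^ 4 = y\<^sup>2\<close>.\<close>

lemma sqrt_abs_le:
  fixes y \<eta> :: real
  assumes "0 < \<eta>"
  shows "sqrt \<bar>y\<bar> \<le> \<eta> + y\<^sup>2 / \<eta> ^ 3"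
proof (cases "\<bar>y\<bar> \<le> \<eta>\<^sup>2")
  case True
  then have "sqrt \<bar>y\<bar> \<le> \<eta>" using assms by (simp add: real_le_lsqrt)
  then show ?thesis using assms by (simp add: add_increasing2)
next
  case False
  define s where "s = sqrt \<bar>y\<bar>"
  have s: "\<eta> \<le> s" "y\<^sup>2 = s ^ 4"
    using False assms unfolding s_def
    by (auto simp: real_le_rsqrt) (metis abs_ge_zero mult_2 numeral_Bit0 power2_abs power_add power_mult real_sqrt_pow2 power2_eq_square)
  have "\<eta> ^ 3 * s \<le> s ^ 3 * s"
    using s assms by (intro mult_right_mono power_mono) auto
  then have "s \<le> y\<^sup>2 / \<eta> ^ 3"
    using s assms by (simp add: field_simps power_numeral_reduce)
  then show ?thesis using assms unfolding s_def by simp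
qed

text \<open>The bound \<open>c\<close> does not depend on the number \<open>m\<close> of sample
  points, so it passes to the mixture once the empirical error tends to 0. Boundedness by
  \<open>T\<close> provides the variance bound.\<close>

lemma sqrt_integral_le_bounded:
  fixes f :: "'a \<Rightarrow> 'b \<Rightarrow> real"
  assumes Q: "prob_space Q" and N: "prob_space N"
    and f[measurable]: "(\<lambda>(x, p). f x p) \<in> borel_measurable (Q \<Otimes>\<^sub>M N)"
    and bnd: "\<And>x p. x \<in> space Q \<Longrightarrow> p \<in> space N \<Longrightarrow> 0 \<le> f x p \<and> f x p \<le> T"
    and S: "AE p in N. p \<in> S"
    and c: "0 \<le> c"
    and fin: "\<And>m ps. m \<ge> 1 \<Longrightarrow> (\<And>k. k < m \<Longrightarrow> ps k \<in> S \<inter> space N) \<Longrightarrow>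
      (\<integral>\<^sup>+x. ennreal (sqrt ((\<Sum>k<m. f x (ps k)) / real m)) \<partial>Q) \<le> ennreal c"
  shows "(\<integral>\<^sup>+x. ennreal (sqrt (\<integral>p. f x p \<partial>N)) \<partial>Q) \<le> ennreal c"
proof (rule ennreal_le_epsilon)
  fix e :: real assume e: "0 < e"
  interpret Q: prob_space Q by fact
  interpret N: prob_space N by fact
  interpret QN: pair_prob_space Q N ..
  define fb where "fb x = (\<integral>p. f x p \<partial>N)" for x
  have fb_m[measurable]: "fb \<in> borel_measurable Q"
    unfolding fb_def by measurable
  define \<eta> where "\<eta> = e / 2"
  have \<eta>: "0 < \<eta>" using e by (simp add: \<eta>_def)
  \<comment> \<open>The mean square error of the average is at most \<open>T\<^sup>2 / m\<close>;
    this \<open>m\<close> makes its contribution after division by \<open>\<eta> ^ 3\<close> at most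
    \<open>\<eta>\<close>.\<close>
  obtain m where m: "real m > T\<^sup>2 / (\<eta> ^ 3 * \<eta>)" using reals_Archimedean2 by blast
  have "0 \<le> T\<^sup>2 / (\<eta> ^ 3 * \<eta>)" using \<eta> by simp
  with m have m1: "m \<ge> 1" by (cases m) auto
  have m2: "T\<^sup>2 / real m / \<eta> ^ 3 \<le> \<eta>"
    using m m1 \<eta> by (simp add: field_simps)
  obtain ps where ps: "\<forall>k<m. ps k \<in> S \<inter> space N"
    and Z: "(\<integral>x. (\<Sum>k<m. f x (ps k) - fb x)\<^sup>2 \<partial>Q) \<le> real m * T\<^sup>2"
    using empirical_approximation[OF Q N f bnd S, of m] unfolding fb_def by blast
  have [measurable]: "(\<lambda>x. f x p) \<in> borel_measurable Q" if "p \<in> space N" for p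
    using measurable_Pair1[OF f that] by simp
  have [measurable]: "(\<lambda>p. f x p) \<in> borel_measurable N" if "x \<in> space Q" for x
    using measurable_Pair2[OF f that] by simp
  define em where "em x = (\<Sum>k<m. f x (ps k)) / real m" for x
  have em_m[measurable]: "em \<in> borel_measurable Q"
    unfolding em_def using ps by (intro borel_measurable_sum borel_measurable_divide) auto
  have int_f: "integrable N (f x)" if "x \<in> space Q" for x
    using that bnd by (intro N.integrable_const_bound[where B=T] AE_I2) auto
  have fb_bnd: "0 \<le> fb x \<and> fb x \<le> T" if "x \<in> space Q" for x
    unfolding fb_def using that bnd int_f[OF that]
    by (auto intro!: integral_nonneg_AE AE_I2 N.integral_le_const)
  have em_bnd: "0 \<le> em x \<and> em x \<le> T" if "x \<in> space Q" for x
  proof -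
    have "(\<Sum>k<m. f x (ps k)) \<le> (\<Sum>k<m. T)" using ps bnd that by (intro sum_mono) auto
    moreover have "0 \<le> (\<Sum>k<m. f x (ps k))" using ps bnd that by (intro sum_nonneg) auto
    ultimately show ?thesis using m1 by (simp add: em_def field_simps)
  qed
  have diff_eq: "(\<Sum>k<m. f x (ps k) - fb x) = real m * (em x - fb x)" for x
    using m1 by (simp add: em_def sum_subtractf field_simps)
  have int2: "integrable Q (\<lambda>x. (em x - fb x)\<^sup>2)"
  proof (intro Q.integrable_const_bound[where B="T\<^sup>2"] AE_I2)
    fix x assume x: "x \<in> space Q"
    have "\<bar>em x - fb x\<bar> \<le> \<bar>T\<bar>" using em_bnd[OF x] fb_bnd[OF x] by auto
    then show "norm ((em x - fb x)\<^sup>2) \<le> T\<^sup>2" by (simp add: abs_le_square_iff)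
  qed simp
  have Z2: "(\<integral>x. (em x - fb x)\<^sup>2 \<partial>Q) \<le> T\<^sup>2 / real m"
  proof -
    have "real m ^ 2 * (\<integral>x. (em x - fb x)\<^sup>2 \<partial>Q) \<le> real m * T\<^sup>2"
      using Z unfolding diff_eq power_mult_distrib by simp
    then show ?thesis using m1 by (simp add: field_simps power2_eq_square)
  qed
  have pt: "sqrt (fb x) \<le> sqrt (em x) + (\<eta> + (em x - fb x)\<^sup>2 / \<eta> ^ 3)" if x: "x \<in> space Q" for x
  proof -
    have "sqrt (fb x) \<le> sqrt (em x + \<bar>em x - fb x\<bar>)" by simp
    also have "\<dots> \<le> sqrt (em x) + sqrt \<bar>em x - fb x\<bar>"
      using em_bnd[OF x] by (intro sqrt_add_le_add_sqrt) auto
    also have "sqrt \<bar>em x - fb x\<bar> \<le> \<eta> + (em x - fb x)\<^sup>2 / \<eta> ^ 3"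
      by (rule sqrt_abs_le[OF \<eta>])
    finally show ?thesis by simp
  qed
  have "(\<integral>\<^sup>+x. ennreal (sqrt (fb x)) \<partial>Q)
      \<le> (\<integral>\<^sup>+x. ennreal (sqrt (em x)) + ennreal (\<eta> + (em x - fb x)\<^sup>2 / \<eta> ^ 3) \<partial>Q)"
    using pt em_bnd \<eta> by (intro nn_integral_mono) (simp flip: ennreal_plus)
  also have "\<dots> = (\<integral>\<^sup>+x. ennreal (sqrt (em x)) \<partial>Q) + (\<integral>\<^sup>+x. ennreal (\<eta> + (em x - fb x)\<^sup>2 / \<eta> ^ 3) \<partial>Q)"
    by (intro nn_integral_add) measurable
  also have "(\<integral>\<^sup>+x. ennreal (\<eta> + (em x - fb x)\<^sup>2 / \<eta> ^ 3) \<partial>Q)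
      = ennreal (\<integral>x. \<eta> + (em x - fb x)\<^sup>2 / \<eta> ^ 3 \<partial>Q)"
    using int2 \<eta> by (intro nn_integral_eq_integral) auto
  also have "(\<integral>x. \<eta> + (em x - fb x)\<^sup>2 / \<eta> ^ 3 \<partial>Q) = \<eta> + (\<integral>x. (em x - fb x)\<^sup>2 \<partial>Q) / \<eta> ^ 3"
    using int2 by (simp add: Q.prob_space)
  also have "(\<integral>\<^sup>+x. ennreal (sqrt (em x)) \<partial>Q) \<le> ennreal c"
    unfolding em_def using ps m1 by (intro fin) auto
  also have "\<eta> + (\<integral>x. (em x - fb x)\<^sup>2 \<partial>Q) / \<eta> ^ 3 \<le> \<eta> + T\<^sup>2 / real m / \<eta> ^ 3"
    using Z2 \<eta> by (intro add_left_mono divide_right_mono) auto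
  also have "\<dots> \<le> \<eta> + \<eta>" using m2 by simp
  also have "\<dots> = e" by (simp add: \<eta>_def)
  finally show "(\<integral>\<^sup>+x. ennreal (sqrt (\<integral>p. f x p \<partial>N)) \<partial>Q) \<le> ennreal c + ennreal e"
    by (simp add: fb_def add_left_mono add_right_mono ennreal_leI)
qed

text \<open>Truncation at height \<open>T\<close> removes the boundedness: it only lowers the finite
  averages, so the hypothesis on them survives. Monotone convergence in \<open>p\<close> and Fatou's
  lemma in \<open>x\<close> then lead back to \<open>F\<close>.\<close>

lemma sqrt_nn_integral_le:
  fixes F :: "'a \<Rightarrow> 'b \<Rightarrow> real"
  assumes Q: "prob_space Q" and N: "prob_space N"
    and F[measurable]: "(\<lambda>(x, p). F x p) \<in> borel_measurable (Q \<Otimes>\<^sub>M N)"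
    and nonneg: "\<And>x p. x \<in> space Q \<Longrightarrow> p \<in> space N \<Longrightarrow> 0 \<le> F x p"
    and S: "AE p in N. p \<in> S"
    and c: "0 \<le> c"
    and fin: "\<And>m ps. m \<ge> 1 \<Longrightarrow> (\<And>k. k < m \<Longrightarrow> ps k \<in> S \<inter> space N) \<Longrightarrow>
      (\<integral>\<^sup>+x. ennreal (sqrt ((\<Sum>k<m. F x (ps k)) / real m)) \<partial>Q) \<le> ennreal c"
  shows "(\<integral>\<^sup>+x. ennreal (sqrt (enn2real (\<integral>\<^sup>+p. ennreal (F x p) \<partial>N))) \<partial>Q) \<le> ennreal c"
proof -
  interpret Q: prob_space Q by fact
  interpret N: prob_space N by fact
  interpret QN: pair_prob_space Q N ..
  define f where "f T x p = min (F x p) (real T)" for T :: nat and x p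
  have fm[measurable]: "(\<lambda>(x, p). f T x p) \<in> borel_measurable (Q \<Otimes>\<^sub>M N)" for T
    unfolding f_def by measurable
  have f_bnd: "0 \<le> f T x p \<and> f T x p \<le> real T" if "x \<in> space Q" "p \<in> space N" for T x p
    using nonneg[OF that] by (auto simp: f_def)
  have [measurable]: "(\<lambda>p. f T x p) \<in> borel_measurable N" if "x \<in> space Q" for T x
    using measurable_Pair2[OF fm that] by simp
  have bound: "(\<integral>\<^sup>+x. ennreal (sqrt (\<integral>p. f T x p \<partial>N)) \<partial>Q) \<le> ennreal c" for T
  proof (rule sqrt_integral_le_bounded[OF Q N fm f_bnd S c])
    fix m :: nat and ps assume m: "m \<ge> 1" and ps: "\<And>k. k < m \<Longrightarrow> ps k \<in> S \<inter> space N"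
    have "(\<integral>\<^sup>+x. ennreal (sqrt ((\<Sum>k<m. f T x (ps k)) / real m)) \<partial>Q)
        \<le> (\<integral>\<^sup>+x. ennreal (sqrt ((\<Sum>k<m. F x (ps k)) / real m)) \<partial>Q)"
      using m by (intro nn_integral_mono ennreal_leI real_sqrt_le_mono divide_right_mono sum_mono) (auto simp: f_def)
    also have "\<dots> \<le> ennreal c" using m ps by (rule fin)
    finally show "(\<integral>\<^sup>+x. ennreal (sqrt ((\<Sum>k<m. f T x (ps k)) / real m)) \<partial>Q) \<le> ennreal c" .
  qed auto
  have lim: "(\<lambda>T. ennreal (sqrt (\<integral>p. f T x p \<partial>N))) \<longlonglongrightarrow> ennreal (sqrt (enn2real (\<integral>\<^sup>+p. ennreal (F x p) \<partial>N)))"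
    if x: "x \<in> space Q" and fin: "(\<integral>\<^sup>+p. ennreal (F x p) \<partial>N) < \<infinity>" for x
  proof -
    have eq: "(\<integral>p. f T x p \<partial>N) = enn2real (\<integral>\<^sup>+p. ennreal (f T x p) \<partial>N)" for T
      using f_bnd[OF x] x by (intro integral_eq_nn_integral) auto
    have pt: "(SUP T. ennreal (f T x p)) = ennreal (F x p)" if "p \<in> space N" for p
    proof (rule SUP_eqI)
      fix y assume y: "\<And>T. T \<in> UNIV \<Longrightarrow> ennreal (f T x p) \<le> y"
      obtain T :: nat where "F x p \<le> real T" using real_arch_simple by blast
      then show "ennreal (F x p) \<le> y" using y[of T] by (simp add: f_def min_absorb1)
    qed (simp add: f_def ennreal_leI)
    have inc: "incseq (\<lambda>T p. ennreal (f T x p))"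
      by (auto simp: incseq_def le_fun_def f_def intro!: ennreal_leI min.mono)
    have "(\<integral>\<^sup>+p. ennreal (F x p) \<partial>N) = (\<integral>\<^sup>+p. (SUP T. ennreal (f T x p)) \<partial>N)"
      using pt by (intro nn_integral_cong) simp
    also have "\<dots> = (SUP T. \<integral>\<^sup>+p. ennreal (f T x p) \<partial>N)"
      using inc x by (intro nn_integral_monotone_convergence_SUP) auto
    finally have "(\<lambda>T. \<integral>\<^sup>+p. ennreal (f T x p) \<partial>N) \<longlonglongrightarrow> (\<integral>\<^sup>+p. ennreal (F x p) \<partial>N)"
      using inc by (auto simp: incseq_def le_fun_def intro!: LIMSEQ_SUP nn_integral_mono)
    then have "(\<lambda>T. enn2real (\<integral>\<^sup>+p. ennreal (f T x p) \<partial>N)) \<longlonglongrightarrow> enn2real (\<integral>\<^sup>+p. ennreal (F x p) \<partial>N)"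
      using fin by (intro tendsto_enn2real) (auto simp: ennreal_enn2real_if)
    then show ?thesis
      unfolding eq by (intro tendsto_ennrealI tendsto_real_sqrt)
  qed
  have "(\<integral>\<^sup>+x. ennreal (sqrt (enn2real (\<integral>\<^sup>+p. ennreal (F x p) \<partial>N))) \<partial>Q)
      \<le> (\<integral>\<^sup>+x. liminf (\<lambda>T. ennreal (sqrt (\<integral>p. f T x p \<partial>N))) \<partial>Q)"
  proof (rule nn_integral_mono)
    fix x assume x: "x \<in> space Q"
    show "ennreal (sqrt (enn2real (\<integral>\<^sup>+p. ennreal (F x p) \<partial>N))) \<le> liminf (\<lambda>T. ennreal (sqrt (\<integral>p. f T x p \<partial>N)))"
    proof (cases "(\<integral>\<^sup>+p. ennreal (F x p) \<partial>N) < \<infinity>")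
      case True
      then show ?thesis using lim_imp_Liminf[OF _ lim[OF x True]] by simp
    next
      case False
      \<comment> \<open>\<open>enn2real\<close> sends an infinite inner integral to 0, so the
        left-hand side vanishes here.\<close>
      then have "(\<integral>\<^sup>+p. ennreal (F x p) \<partial>N) = \<top>" by (metis infinity_ennreal_def top.not_eq_extremum)
      then show ?thesis by simp
    qed
  qed
  also have "\<dots> \<le> liminf (\<lambda>T. \<integral>\<^sup>+x. ennreal (sqrt (\<integral>p. f T x p \<partial>N)) \<partial>Q)"
    by (intro nn_integral_liminf) measurable
  also have "\<dots> \<le> ennreal c"
    using bound by (intro Liminf_le) auto
  finally show ?thesis .
qed

section \<open>Hellinger affinity of mixtures over convex balls\<close>

lemma densitiesD:
  assumes "p \<in> densities M"
  shows densities_measurable: "p \<in> borel_measurable M"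
    and densities_nonneg: "x \<in> space M \<Longrightarrow> 0 \<le> p x"
    and densities_nn_integral: "(\<integral>\<^sup>+x. ennreal (p x) \<partial>M) = 1"
    and densities_integrable: "integrable M p"
    and densities_integral: "(\<integral>x. p x \<partial>M) = 1"
proof -
  show 1: "p \<in> borel_measurable M" "x \<in> space M \<Longrightarrow> 0 \<le> p x" "(\<integral>\<^sup>+x. ennreal (p x) \<partial>M) = 1" for x
    using assms by (auto simp: densities_def)
  then show "integrable M p"
    by (intro integrableI_nonneg) (auto intro!: AE_I2)
  show "(\<integral>x. p x \<partial>M) = 1"
    using 1 by (subst integral_eq_nn_integral) (auto intro!: AE_I2)
qed

lemma sets_law [measurable_cong, simp]: "sets (law M p) = sets M"
  and space_law [simp]: "space (law M p) = space M"
  by (simp_all add: law_def)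

lemma prob_space_law: "p \<in> densities M \<Longrightarrow> prob_space (law M p)"
  using densities_measurable[of p M] densities_nn_integral[of p M]
  by (intro prob_spaceI) (simp add: law_def emeasure_density cong: nn_integral_cong)

lemma AE_law_pos:
  assumes "p \<in> densities M"
  shows "AE x in law M p. 0 < p x"
  using densities_measurable[OF assms] unfolding law_def by (subst AE_density) auto

lemma prob_space_sample_law: "p \<in> densities M \<Longrightarrow> prob_space (sample_law M p n)"
  unfolding sample_law_def by (intro prob_space_PiM prob_space_law)

lemma nn_integral_law:
  assumes "p \<in> densities M" and [measurable]: "f \<in> borel_measurable M"
  shows "(\<integral>\<^sup>+x. f x \<partial>law M p) = (\<integral>\<^sup>+x. ennreal (p x) * f x \<partial>M)"
  using densities_measurable[OF assms(1)] unfolding law_def by (subst nn_integral_density) auto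

text \<open>The left-hand side is the Hellinger affinity, the integral of
  \<open>sqrt (q x * p0 x)\<close>, which equals \<open>1 - h\<^sup>2 / 2\<close> for the Hellinger
  distance \<open>h\<close>.\<close>

lemma affinity_le:
  assumes p0: "p0 \<in> densities M" and q: "q \<in> densities M"
    and \<delta>: "0 \<le> \<delta>" "\<delta> \<le> hellinger M q p0"
  shows "(\<integral>\<^sup>+x. ennreal (sqrt (q x / p0 x)) \<partial>law M p0) \<le> ennreal (exp (- \<delta>\<^sup>2 / 2))"
proof -
  note [measurable] = densities_measurable[OF p0] densities_measurable[OF q]
  note nn = densities_nonneg[OF p0] densities_nonneg[OF q]
  have int: "integrable M (\<lambda>x. sqrt (q x * p0 x))"
  proof (rule Bochner_Integration.integrable_bound)
    show "integrable M (\<lambda>x. q x + p0 x)"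
      using densities_integrable[OF p0] densities_integrable[OF q] by simp
    show "AE x in M. norm (sqrt (q x * p0 x)) \<le> norm (q x + p0 x)"
    proof (rule AE_I2)
      fix x assume "x \<in> space M"
      then have "sqrt (q x * p0 x) \<le> (q x + p0 x) / 2" "0 \<le> q x" "0 \<le> p0 x"
        using nn arith_geo_mean_sqrt[of "q x" "p0 x"] by auto
      then show "norm (sqrt (q x * p0 x)) \<le> norm (q x + p0 x)" by simp
    qed
  qed measurable
  have "(hellinger M q p0)\<^sup>2 = (\<integral>x. (sqrt (q x) - sqrt (p0 x))\<^sup>2 \<partial>M)"
    unfolding hellinger_def by (intro real_sqrt_pow2 integral_nonneg_AE AE_I2) simp
  also have "\<dots> = (\<integral>x. q x + p0 x - 2 * sqrt (q x * p0 x) \<partial>M)"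
    using nn by (intro Bochner_Integration.integral_cong refl) (simp add: power2_diff real_sqrt_mult)
  also have "\<dots> = 2 - 2 * (\<integral>x. sqrt (q x * p0 x) \<partial>M)"
    using int p0 q by (simp add: densities_integrable densities_integral)
  finally have h: "(\<integral>x. sqrt (q x * p0 x) \<partial>M) = 1 - (hellinger M q p0)\<^sup>2 / 2" by linarith
  have "(\<integral>\<^sup>+x. ennreal (sqrt (q x / p0 x)) \<partial>law M p0) = (\<integral>\<^sup>+x. ennreal (p0 x) * ennreal (sqrt (q x / p0 x)) \<partial>M)"
    by (intro nn_integral_law p0) measurable
  also have "\<dots> = (\<integral>\<^sup>+x. ennreal (sqrt (q x * p0 x)) \<partial>M)"
  proof (rule nn_integral_cong)
    fix x assume "x \<in> space M"
    then have "0 \<le> p0 x" "0 \<le> q x" using nn by auto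
    moreover from this have "p0 x * sqrt (q x / p0 x) = sqrt (q x * p0 x)"
      \<comment> \<open>At zeros of \<open>p0\<close> the quotient is 0 by convention, and both
        sides vanish.\<close>
      by (cases "p0 x = 0") (simp_all add: real_sqrt_divide real_sqrt_mult field_simps)
    ultimately show "ennreal (p0 x) * ennreal (sqrt (q x / p0 x)) = ennreal (sqrt (q x * p0 x))"
      by (simp flip: ennreal_mult)
  qed
  also have "\<dots> = ennreal (1 - (hellinger M q p0)\<^sup>2 / 2)"
    using int nn h by (subst nn_integral_eq_integral) (auto intro!: AE_I2)
  also have "1 - (hellinger M q p0)\<^sup>2 / 2 \<le> 1 - \<delta>\<^sup>2 / 2"
    using \<delta> by (intro diff_left_mono divide_right_mono power_mono) auto
  also have "\<dots> \<le> exp (- \<delta>\<^sup>2 / 2)"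
    using exp_ge_add_one_self[of "- \<delta>\<^sup>2 / 2"] by simp
  finally show ?thesis by (simp add: ennreal_leI)
qed

text \<open>Two-point convexity extended by induction to finite combinations. Weights may be zero,
  so the partial sum cannot always be normalised; in that case only the new point remains.\<close>

lemma density_ball_sum:
  assumes conv: "convex_balls M d" and c: "c \<in> densities M"
    and "finite J" "\<And>l. l \<in> J \<Longrightarrow> 0 \<le> b l" "\<And>l. l \<in> J \<Longrightarrow> ps l \<in> density_ball M d c r"
    and "0 < sum b J"
  shows "(\<lambda>x. (\<Sum>l\<in>J. b l * ps l x) / sum b J) \<in> density_ball M d c r"
  using assms(3-)
proof (induction J rule: finite_induct)
  case empty
  then show ?case by simp
next
  case (insert i J)
  define s where "s = sum b J"
  have s0: "0 \<le> s" unfolding s_def using insert.prems by (intro sum_nonneg) auto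
  have bi: "0 \<le> b i" and pi: "ps i \<in> density_ball M d c r" using insert.prems by auto
  show ?case
  proof (cases "s = 0")
    case True
    then have "\<forall>l\<in>J. b l = 0"
      using insert.prems insert.hyps unfolding s_def by (subst (asm) sum_nonneg_eq_0_iff) auto
    moreover have "b i > 0" using insert.prems insert.hyps True by (simp add: s_def)
    ultimately have "(\<lambda>x. (\<Sum>l\<in>insert i J. b l * ps l x) / sum b (insert i J)) = ps i"
      using insert.hyps by (auto simp: fun_eq_iff)
    then show ?thesis using pi by simp
  next
    case False
    then have s: "0 < s" using s0 by simp
    define q where "q x = (\<Sum>l\<in>J. b l * ps l x) / s" for x
    have "q \<in> density_ball M d c r"
      unfolding q_def s_def using insert s by (intro insert.IH) (auto simp: s_def)
    then have "(\<lambda>x. (1 - b i / (b i + s)) * q x + b i / (b i + s) * ps i x) \<in> density_ball M d c r"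
      using conv[unfolded convex_balls_def, rule_format, OF c _ pi, of q "b i / (b i + s)"] bi s by simp
    also have "(\<lambda>x. (1 - b i / (b i + s)) * q x + b i / (b i + s) * ps i x)
        = (\<lambda>x. (\<Sum>l\<in>insert i J. b l * ps l x) / sum b (insert i J))"
    proof
      fix x
      have "1 - b i / (b i + s) = s / (b i + s)" using bi s by (simp add: field_simps)
      then show "(1 - b i / (b i + s)) * q x + b i / (b i + s) * ps i x
          = (\<Sum>l\<in>insert i J. b l * ps l x) / sum b (insert i J)"
        using insert.hyps s bi by (simp add: q_def flip: s_def add_divide_distrib)
    qed
    finally show ?thesis .
  qed
qed

text \<open>The mixture is its total weight times the ratio of a single density \<open>q\<close> of
  the ball to \<open>p0\<close>. The square root takes out the total weight, and
  \<open>d \<le> hellinger\<close> turns the \<open>d\<close>-separation into a Hellinger separation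
  of \<open>q\<close> from \<open>p0\<close>.\<close>

lemma density_ball_affinity:
  assumes p0: "p0 \<in> densities M" and conv: "convex_balls M d" and c: "c \<in> densities M"
    and le_h: "\<And>p q. p \<in> densities M \<Longrightarrow> q \<in> densities M \<Longrightarrow> d p q \<le> hellinger M p q"
    and \<delta>: "0 \<le> \<delta>" "\<And>q. q \<in> density_ball M d c r \<Longrightarrow> \<delta> \<le> d q p0"
    and J: "finite J" "\<And>l. l \<in> J \<Longrightarrow> 0 \<le> b l" "\<And>l. l \<in> J \<Longrightarrow> ps l \<in> density_ball M d c r"
  shows "(\<integral>\<^sup>+x. ennreal (sqrt (\<Sum>l\<in>J. b l * (ps l x / p0 x))) \<partial>law M p0)
    \<le> ennreal (sqrt (sum b J) * exp (- \<delta>\<^sup>2 / 2))"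
proof (cases "sum b J = 0")
  case True
  then have "\<forall>l\<in>J. b l = 0" using J by (subst (asm) sum_nonneg_eq_0_iff) auto
  then show ?thesis by simp
next
  case False
  then have s: "0 < sum b J" using J by (simp add: sum_nonneg order_less_le)
  define q where "q x = (\<Sum>l\<in>J. b l * ps l x) / sum b J" for x
  have qb: "q \<in> density_ball M d c r"
    unfolding q_def using conv c J s by (rule density_ball_sum)
  then have q: "q \<in> densities M" by (simp add: density_ball_def)
  have qh: "\<delta> \<le> hellinger M q p0" using \<delta>(2)[OF qb] le_h[OF q p0] by simp
  note [measurable] = densities_measurable[OF p0] densities_measurable[OF q]
  have eq: "sqrt (\<Sum>l\<in>J. b l * (ps l x / p0 x)) = sqrt (sum b J) * sqrt (q x / p0 x)" for x
  proof -
    have "(\<Sum>l\<in>J. b l * (ps l x / p0 x)) = sum b J * (q x / p0 x)"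
      using s by (simp add: q_def sum_divide_distrib[symmetric])
    then show ?thesis by (simp only: real_sqrt_mult)
  qed
  have "(\<integral>\<^sup>+x. ennreal (sqrt (\<Sum>l\<in>J. b l * (ps l x / p0 x))) \<partial>law M p0)
      = (\<integral>\<^sup>+x. ennreal (sqrt (sum b J)) * ennreal (sqrt (q x / p0 x)) \<partial>law M p0)"
    unfolding eq using s densities_nonneg[OF p0] densities_nonneg[OF q]
    by (intro nn_integral_cong) (simp add: ennreal_mult)
  also have "\<dots> = ennreal (sqrt (sum b J)) * (\<integral>\<^sup>+x. ennreal (sqrt (q x / p0 x)) \<partial>law M p0)"
    by (intro nn_integral_cmult) measurable
  also have "\<dots> \<le> ennreal (sqrt (sum b J)) * ennreal (exp (- \<delta>\<^sup>2 / 2))"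
    by (intro mult_left_mono affinity_le p0 q \<delta> qh) auto
  finally show ?thesis using s by (simp add: ennreal_mult)
qed

lemma density_ball_product_affinity:
  assumes p0: "p0 \<in> densities M" and conv: "convex_balls M d" and c: "c \<in> densities M"
    and le_h: "\<And>p q. p \<in> densities M \<Longrightarrow> q \<in> densities M \<Longrightarrow> d p q \<le> hellinger M p q"
    and \<delta>: "0 \<le> \<delta>" "\<And>q. q \<in> density_ball M d c r \<Longrightarrow> \<delta> \<le> d q p0"
    and J: "finite J" "\<And>l. l \<in> J \<Longrightarrow> 0 \<le> b l" "\<And>l. l \<in> J \<Longrightarrow> ps l \<in> density_ball M d c r"
  shows "(\<integral>\<^sup>+X. ennreal (sqrt (\<Sum>l\<in>J. b l * (\<Prod>i<n. ps l (X i) / p0 (X i)))) \<partial>sample_law M p0 n)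
    \<le> ennreal (sqrt (sum b J) * exp (- real n * \<delta>\<^sup>2 / 2))"
proof (induction n)
  case 0
  interpret prob_space "sample_law M p0 0" by (rule prob_space_sample_law[OF p0])
  show ?case by (simp add: emeasure_space_1)
next
  case (Suc n)
  interpret P: prob_space "law M p0" by (rule prob_space_law[OF p0])
  interpret PP: product_prob_space "\<lambda>_::nat. law M p0" "{..<n}" ..
  have psd: "ps l \<in> densities M" if "l \<in> J" for l using J(3)[OF that] by (simp add: density_ball_def)
  note [measurable] = densities_measurable[OF p0]
  have [measurable]: "ps l \<in> borel_measurable M" if "l \<in> J" for l using densities_measurable[OF psd[OF that]] .
  let ?F = "\<lambda>n X. \<Sum>l\<in>J. b l * (\<Prod>i<n. ps l (X i) / p0 (X i))"
  have Fm: "(\<lambda>X. ennreal (sqrt (?F m X))) \<in> borel_measurable (Pi\<^sub>M {..<m} (\<lambda>_. law M p0))" for m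
    by measurable
  have "(\<integral>\<^sup>+X. ennreal (sqrt (?F (Suc n) X)) \<partial>sample_law M p0 (Suc n))
      = (\<integral>\<^sup>+X. \<integral>\<^sup>+y. ennreal (sqrt (?F (Suc n) (X(n := y)))) \<partial>law M p0 \<partial>Pi\<^sub>M {..<n} (\<lambda>_. law M p0))"
    using Fm[of "Suc n"] unfolding sample_law_def lessThan_Suc
    by (intro PP.product_nn_integral_insert) auto
  also have "\<dots> \<le> (\<integral>\<^sup>+X. ennreal (sqrt (?F n X)) * ennreal (exp (- \<delta>\<^sup>2 / 2)) \<partial>Pi\<^sub>M {..<n} (\<lambda>_. law M p0))"
  proof (rule nn_integral_mono)
    fix X assume X: "X \<in> space (Pi\<^sub>M {..<n} (\<lambda>_. law M p0))"
    then have Xi: "X i \<in> space M" if "i < n" for i using that by (auto simp: space_PiM PiE_def)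
    \<comment> \<open>The factors of the first \<open>n\<close> observations are absorbed into the
      weights. The one-observation bound allows arbitrary nonnegative weights and returns
      \<open>sqrt (sum a J)\<close>, which is the integrand for \<open>n\<close>.\<close>
    define a where "a l = b l * (\<Prod>i<n. ps l (X i) / p0 (X i))" for l
    have a: "0 \<le> a l" if "l \<in> J" for l
      unfolding a_def using that J(2) densities_nonneg[OF psd[OF that]] densities_nonneg[OF p0] Xi
      by (intro mult_nonneg_nonneg prod_nonneg divide_nonneg_nonneg) auto
    have "?F (Suc n) (X(n := y)) = (\<Sum>l\<in>J. a l * (ps l y / p0 y))" for y
      by (intro sum.cong) (auto simp: a_def algebra_simps intro!: prod.cong)
    then have "(\<integral>\<^sup>+y. ennreal (sqrt (?F (Suc n) (X(n := y)))) \<partial>law M p0)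
        = (\<integral>\<^sup>+y. ennreal (sqrt (\<Sum>l\<in>J. a l * (ps l y / p0 y))) \<partial>law M p0)" by simp
    also have "\<dots> \<le> ennreal (sqrt (sum a J) * exp (- \<delta>\<^sup>2 / 2))"
      by (rule density_ball_affinity[OF p0 conv c le_h \<delta> J(1) a J(3)])
    also have "\<dots> = ennreal (sqrt (?F n X)) * ennreal (exp (- \<delta>\<^sup>2 / 2))"
      using a by (simp add: ennreal_mult sum_nonneg flip: a_def)
    finally show "(\<integral>\<^sup>+y. ennreal (sqrt (?F (Suc n) (X(n := y)))) \<partial>law M p0)
        \<le> ennreal (sqrt (?F n X)) * ennreal (exp (- \<delta>\<^sup>2 / 2))" .
  qed
  also have "\<dots> = (\<integral>\<^sup>+X. ennreal (sqrt (?F n X)) \<partial>Pi\<^sub>M {..<n} (\<lambda>_. law M p0)) * ennreal (exp (- \<delta>\<^sup>2 / 2))"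
    using Fm[of n] by (intro nn_integral_multc)
  also have "\<dots> \<le> ennreal (sqrt (sum b J) * exp (- real n * \<delta>\<^sup>2 / 2)) * ennreal (exp (- \<delta>\<^sup>2 / 2))"
    using Suc.IH unfolding sample_law_def by (intro mult_right_mono) auto
  also have "\<dots> = ennreal (sqrt (sum b J) * exp (- real (Suc n) * \<delta>\<^sup>2 / 2))"
    using J by (simp add: sum_nonneg field_simps add_divide_distrib flip: ennreal_mult exp_add)
  finally show ?case .
qed

section \<open>Joint measurability of likelihood ratios, and mixtures over a covered set of
  densities\<close>

lemma model_priorD:
  assumes "model_prior M N"
  shows model_prior_prob_space: "prob_space N"
    and model_prior_densities: "p \<in> space N \<Longrightarrow> p \<in> densities M"
    and model_prior_measurable: "(\<lambda>(x, p). p x) \<in> borel_measurable (M \<Otimes>\<^sub>M N)"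
  using assms by (auto simp: model_prior_def)

lemma likelihood_ratio_coordinate_measurable:
  assumes p0: "p0 \<in> densities M" and N: "model_prior M N" and "i < n"
  shows "(\<lambda>(X, p). p (X i) / p0 (X i)) \<in> borel_measurable (sample_law M p0 n \<Otimes>\<^sub>M N)"
proof -
  note [measurable] = densities_measurable[OF p0] model_prior_measurable[OF N]
  have [measurable]: "(\<lambda>X. X i) \<in> sample_law M p0 n \<rightarrow>\<^sub>M M"
    unfolding sample_law_def using \<open>i < n\<close>
    by (subst measurable_cong_sets[OF refl sets_law[symmetric]]) (rule measurable_component_singleton, simp)
  have "(\<lambda>(X, p). (X i, p)) \<in> (sample_law M p0 n \<Otimes>\<^sub>M N) \<rightarrow>\<^sub>M (M \<Otimes>\<^sub>M N)"
    by measurable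
  from measurable_compose[OF this model_prior_measurable[OF N]]
  have [measurable]: "(\<lambda>(X, p). p (X i)) \<in> borel_measurable (sample_law M p0 n \<Otimes>\<^sub>M N)"
    by (simp add: case_prod_beta')
  show ?thesis by measurable
qed

lemma likelihood_ratio_measurable:
  assumes p0: "p0 \<in> densities M" and N: "model_prior M N"
  shows "(\<lambda>(X, p). \<Prod>i<n. p (X i) / p0 (X i)) \<in> borel_measurable (sample_law M p0 n \<Otimes>\<^sub>M N)"
  using likelihood_ratio_coordinate_measurable[OF p0 N]
  by (auto simp: case_prod_beta' intro!: borel_measurable_prod)

lemma sample_law_space: "X \<in> space (sample_law M p0 n) \<Longrightarrow> i < n \<Longrightarrow> X i \<in> space M"
  by (auto simp: sample_law_def space_PiM PiE_def)

lemma sum_sqrt_subadd: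
  assumes "finite C" "\<And>c. c \<in> C \<Longrightarrow> 0 \<le> f c"
  shows "sqrt (sum f C) \<le> (\<Sum>c\<in>C. sqrt (f c :: real))"
  using assms
proof (induction C rule: finite_induct)
  case (insert c C)
  have "sqrt (f c + sum f C) \<le> sqrt (f c) + sqrt (sum f C)"
    using insert.prems by (intro sqrt_add_le_add_sqrt sum_nonneg) auto
  then show ?case using insert by fastforce
qed simp

text \<open>
  The balls need not be measurable for the prior: approximating the mixture by empirical ones
  reduces the estimate to finitely many densities, which can be distributed over the balls.
\<close>

lemma sqrt_likelihood_cover:
  assumes p0: "p0 \<in> densities M" and conv: "convex_balls M d"
    and le_h: "\<And>p q. p \<in> densities M \<Longrightarrow> q \<in> densities M \<Longrightarrow> d p q \<le> hellinger M p q"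
    and N: "model_prior M N" and S: "S \<in> sets N"
    and C: "finite C" "C \<subseteq> densities M" "S \<subseteq> (\<Union>c\<in>C. density_ball M d c r)"
    and \<delta>: "0 \<le> \<delta>"
      "\<And>c p q. c \<in> C \<Longrightarrow> p \<in> S \<Longrightarrow> p \<in> density_ball M d c r \<Longrightarrow> q \<in> density_ball M d c r \<Longrightarrow> \<delta> \<le> d q p0"
  shows "(\<integral>\<^sup>+X. ennreal (sqrt (enn2real (\<integral>\<^sup>+p\<in>S. ennreal (\<Prod>i<n. p (X i) / p0 (X i)) \<partial>N))) \<partial>sample_law M p0 n)
    \<le> ennreal (sqrt (measure N S) * (real (card C) * exp (- real n * \<delta>\<^sup>2 / 2)))"
proof (cases "measure N S = 0")
  case True
  interpret N: prob_space N by (rule model_prior_prob_space[OF N])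
  have "S \<in> null_sets N" using True S by (simp add: null_sets_def N.emeasure_eq_measure)
  then show ?thesis using True by (simp add: nn_integral_null_set)
next
  case False
  interpret N: prob_space N by (rule model_prior_prob_space[OF N])
  interpret Q: prob_space "sample_law M p0 n" by (rule prob_space_sample_law[OF p0])
  have S_pos: "0 < measure N S" using False by (simp add: zero_less_measure_iff)
  \<comment> \<open>The prior conditioned on \<open>S\<close>, so that the mixture is one over a
    probability measure; the factor \<open>sqrt (measure N S)\<close> is restored at the end by
    \<open>scale\<close>.\<close>
  define U where "U = uniform_measure N S"
  have sets_U[measurable_cong, simp]: "sets U = sets N" and space_U[simp]: "space U = space N" by (simp_all add: U_def)
  have U: "prob_space U"
    unfolding U_def using S_pos by (intro prob_space_uniform_measure) (auto simp: N.emeasure_eq_measure)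
  have S_sub: "S \<subseteq> space N" using S by (rule sets.sets_into_space)
  have U_S: "AE p in U. p \<in> S"
    unfolding U_def using S by (intro AE_uniform_measureI) auto
  define F where "F X p = (\<Prod>i<n. p (X i) / p0 (X i))" for X :: "nat \<Rightarrow> 'a" and p
  have Fm: "(\<lambda>(X, p). F X p) \<in> borel_measurable (sample_law M p0 n \<Otimes>\<^sub>M N)"
    unfolding F_def by (rule likelihood_ratio_measurable[OF p0 N])
  have FmU: "(\<lambda>(X, p). F X p) \<in> borel_measurable (sample_law M p0 n \<Otimes>\<^sub>M U)"
    using Fm by (simp cong: measurable_cong_sets sets_pair_measure_cong)
  have Fx: "(\<lambda>X. F X p) \<in> borel_measurable (sample_law M p0 n)" if "p \<in> space N" for p
    using measurable_Pair1[OF Fm that] by simp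
  have Fp: "(\<lambda>p. F X p) \<in> borel_measurable N" if "X \<in> space (sample_law M p0 n)" for X
    using measurable_Pair2[OF Fm that] by simp
  have F0: "0 \<le> F X p" if "X \<in> space (sample_law M p0 n)" "p \<in> space N" for X p
    unfolding F_def using that sample_law_space[OF that(1)] densities_nonneg[OF p0]
      densities_nonneg[OF model_prior_densities[OF N that(2)]]
    by (intro prod_nonneg divide_nonneg_nonneg) auto
  let ?e = "exp (- real n * \<delta>\<^sup>2 / 2)"
  have mix: "(\<integral>\<^sup>+X. ennreal (sqrt (enn2real (\<integral>\<^sup>+p. ennreal (F X p) \<partial>U))) \<partial>sample_law M p0 n)
    \<le> ennreal (real (card C) * ?e)"
  proof (rule sqrt_nn_integral_le[OF Q.prob_space_axioms U FmU _ U_S])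
    fix m :: nat and ps assume m: "m \<ge> 1" and ps: "\<And>k. k < m \<Longrightarrow> ps k \<in> S \<inter> space U"
    have "\<exists>c. c \<in> C \<and> ps k \<in> density_ball M d c r" if "k < m" for k
      using ps[OF that] C(3) by auto
    \<comment> \<open>Each sample point is assigned to one ball containing it, which groups the
      finite average without any measurability of the balls.\<close>
    then obtain ct where ct: "\<And>k. k < m \<Longrightarrow> ct k \<in> C \<and> ps k \<in> density_ball M d (ct k) r" by metis
    define J where "J c = {k. k < m \<and> ct k = c}" for c
    have finJ: "finite (J c)" for c by (simp add: J_def)
    define G where "G c X = (\<Sum>k\<in>J c. 1 / real m * F X (ps k))" for c X
    have Gm: "G c \<in> borel_measurable (sample_law M p0 n)" for c
      unfolding G_def using Fx ps by (intro borel_measurable_sum borel_measurable_times) (auto simp: J_def)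
    have G0: "0 \<le> G c X" if "X \<in> space (sample_law M p0 n)" for c X
      unfolding G_def using F0[OF that] ps by (intro sum_nonneg mult_nonneg_nonneg) (auto simp: J_def)
    have split: "(\<Sum>k<m. F X (ps k)) / real m = (\<Sum>c\<in>C. G c X)" for X
    proof -
      have "(\<Sum>k<m. F X (ps k)) / real m = (\<Sum>k\<in>{..<m}. 1 / real m * F X (ps k))"
        by (simp add: sum_divide_distrib)
      also have "\<dots> = (\<Sum>c\<in>C. \<Sum>k\<in>{k\<in>{..<m}. ct k = c}. 1 / real m * F X (ps k))"
        using C ct by (intro sum.group[symmetric]) auto
      finally show ?thesis by (simp add: G_def J_def)
    qed
    have "(\<integral>\<^sup>+X. ennreal (sqrt ((\<Sum>k<m. F X (ps k)) / real m)) \<partial>sample_law M p0 n)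
        \<le> (\<integral>\<^sup>+X. (\<Sum>c\<in>C. ennreal (sqrt (G c X))) \<partial>sample_law M p0 n)"
      unfolding split using G0 C(1)
      by (intro nn_integral_mono) (auto intro!: ennreal_leI sum_sqrt_subadd simp: sum_ennreal)
    also have "\<dots> = (\<Sum>c\<in>C. \<integral>\<^sup>+X. ennreal (sqrt (G c X)) \<partial>sample_law M p0 n)"
      using Gm by (intro nn_integral_sum) auto
    also have "\<dots> \<le> (\<Sum>c\<in>C. ennreal ?e)"
    proof (rule sum_mono)
      fix c assume c: "c \<in> C"
      show "(\<integral>\<^sup>+X. ennreal (sqrt (G c X)) \<partial>sample_law M p0 n) \<le> ennreal ?e"
      proof (cases "J c = {}")
        case True
        then show ?thesis by (simp add: G_def)
      next
        case False
        \<comment> \<open>The separation of a ball from \<open>p0\<close> is known only if the ball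
          meets \<open>S\<close>; the sample point \<open>k0\<close> assigned to it is the witness.
          Balls without sample points contribute 0.\<close>
        then obtain k0 where k0: "k0 < m" "ct k0 = c" by (auto simp: J_def)
        have \<delta>c: "\<delta> \<le> d q p0" if "q \<in> density_ball M d c r" for q
          using \<delta>(2)[OF c _ _ that, of "ps k0"] ct[OF k0(1)] ps[OF k0(1)] k0(2) by auto
        have "(\<integral>\<^sup>+X. ennreal (sqrt (G c X)) \<partial>sample_law M p0 n)
            \<le> ennreal (sqrt (\<Sum>k\<in>J c. 1 / real m) * ?e)"
          unfolding G_def F_def
          by (rule density_ball_product_affinity[OF p0 conv _ le_h \<delta>(1) \<delta>c])
            (use c C(2) ct in \<open>auto simp: J_def\<close>)
        also have "\<dots> \<le> ennreal (1 * ?e)"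
        proof (intro ennreal_leI mult_right_mono)
          \<comment> \<open>The weight of a group is bounded crudely by 1, so each ball costs a full
            factor and the balls together cost \<open>card C\<close>.\<close>
          have "card (J c) \<le> m"
            using card_mono[of "{..<m}" "J c"] by (auto simp: J_def)
          then show "sqrt (\<Sum>k\<in>J c. 1 / real m) \<le> 1" using m by simp
        qed simp
        finally show ?thesis by simp
      qed
    qed
    also have "\<dots> = ennreal (real (card C) * ?e)"
      by (simp add: ennreal_mult ennreal_of_nat_eq_real_of_nat)
    finally show "(\<integral>\<^sup>+X. ennreal (sqrt ((\<Sum>k<m. F X (ps k)) / real m)) \<partial>sample_law M p0 n)
      \<le> ennreal (real (card C) * ?e)" .
  qed (use F0 in auto)
  have scale: "sqrt (enn2real (\<integral>\<^sup>+p\<in>S. ennreal (F X p) \<partial>N))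
      = sqrt (measure N S) * sqrt (enn2real (\<integral>\<^sup>+p. ennreal (F X p) \<partial>U))"
    if "X \<in> space (sample_law M p0 n)" for X
  proof -
    have "(\<integral>\<^sup>+p. ennreal (F X p) \<partial>U) = (\<integral>\<^sup>+p\<in>S. ennreal (F X p) \<partial>N) / emeasure N S"
      unfolding U_def using Fp[OF that] S by (intro nn_integral_uniform_measure) auto
    then have "(\<integral>\<^sup>+p\<in>S. ennreal (F X p) \<partial>N) = ennreal (measure N S) * (\<integral>\<^sup>+p. ennreal (F X p) \<partial>U)"
      using S_pos mult_divide_eq_ennreal[of "ennreal (measure N S)" "\<integral>\<^sup>+p\<in>S. ennreal (F X p) \<partial>N"]
      by (simp add: N.emeasure_eq_measure ennreal_times_divide mult.commute[of _ "\<integral>\<^sup>+p\<in>S. ennreal (F X p) \<partial>N"])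
    then show ?thesis by (simp add: enn2real_mult real_sqrt_mult)
  qed
  have "(\<integral>\<^sup>+X. ennreal (sqrt (enn2real (\<integral>\<^sup>+p\<in>S. ennreal (F X p) \<partial>N))) \<partial>sample_law M p0 n)
      = (\<integral>\<^sup>+X. ennreal (sqrt (measure N S)) * ennreal (sqrt (enn2real (\<integral>\<^sup>+p. ennreal (F X p) \<partial>U))) \<partial>sample_law M p0 n)"
    using scale by (intro nn_integral_cong) (simp add: ennreal_mult)
  also have "\<dots> = ennreal (sqrt (measure N S)) * (\<integral>\<^sup>+X. ennreal (sqrt (enn2real (\<integral>\<^sup>+p. ennreal (F X p) \<partial>U))) \<partial>sample_law M p0 n)"
  proof -
    interpret U: prob_space U by fact
    note [measurable] = FmU
    show ?thesis by (intro nn_integral_cmult) measurable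
  qed
  also have "\<dots> \<le> ennreal (sqrt (measure N S)) * ennreal (real (card C) * ?e)"
    by (intro mult_left_mono mix) auto
  finally show ?thesis by (simp add: F_def ennreal_mult)
qed

section \<open>Lower bound for the evidence\<close>

text \<open>The induction step for a variance of a sum: \<open>s\<close> stands for the sum over the
  earlier observations, and the cross term vanishes because \<open>g\<close> is centred.\<close>

lemma (in prob_space) second_moment_shift:
  fixes g :: "'a \<Rightarrow> real"
  assumes "integrable M g" "integrable M (\<lambda>x. (g x)\<^sup>2)" "expectation g = 0"
  shows "(\<integral>\<^sup>+y. ennreal ((s + g y)\<^sup>2) \<partial>M) = ennreal (s\<^sup>2) + ennreal (expectation (\<lambda>x. (g x)\<^sup>2))"
proof -
  have eq: "(s + g y)\<^sup>2 = s\<^sup>2 + 2 * s * g y + (g y)\<^sup>2" for y by (simp add: power2_sum)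
  have "integrable M (\<lambda>y. (s + g y)\<^sup>2)" unfolding eq using assms by simp
  then have "(\<integral>\<^sup>+y. ennreal ((s + g y)\<^sup>2) \<partial>M) = ennreal (\<integral>y. (s + g y)\<^sup>2 \<partial>M)"
    by (intro nn_integral_eq_integral) auto
  also have "(\<integral>y. (s + g y)\<^sup>2 \<partial>M) = s\<^sup>2 + expectation (\<lambda>x. (g x)\<^sup>2)"
    unfolding eq using assms by (simp add: prob_space)
  finally show ?thesis by (simp add: ennreal_plus)
qed

lemma (in prob_space) second_moment_sum:
  fixes g :: "'a \<Rightarrow> real"
  assumes g: "integrable M g" "integrable M (\<lambda>x. (g x)\<^sup>2)" "expectation g = 0"
  shows "(\<integral>\<^sup>+X. ennreal ((\<Sum>i<n. g (X i))\<^sup>2) \<partial>Pi\<^sub>M {..<n} (\<lambda>_. M)) = ennreal (real n * expectation (\<lambda>x. (g x)\<^sup>2))"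
proof (induction n)
  case (Suc n)
  interpret PP: product_prob_space "\<lambda>_::nat. M" "{..<n}" ..
  have Pn: "prob_space (Pi\<^sub>M {..<n} (\<lambda>_. M))" by (intro prob_space_PiM prob_space_axioms)
  have [measurable]: "g \<in> borel_measurable M" using g(1) by auto
  have "(\<integral>\<^sup>+X. ennreal ((\<Sum>i<Suc n. g (X i))\<^sup>2) \<partial>Pi\<^sub>M {..<Suc n} (\<lambda>_. M))
      = (\<integral>\<^sup>+X. \<integral>\<^sup>+y. ennreal ((\<Sum>i<Suc n. g ((X(n := y)) i))\<^sup>2) \<partial>M \<partial>Pi\<^sub>M {..<n} (\<lambda>_. M))"
    unfolding lessThan_Suc by (intro PP.product_nn_integral_insert) auto
  also have "\<dots> = (\<integral>\<^sup>+X. \<integral>\<^sup>+y. ennreal (((\<Sum>i<n. g (X i)) + g y)\<^sup>2) \<partial>M \<partial>Pi\<^sub>M {..<n} (\<lambda>_. M))"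
    by (intro nn_integral_cong) simp
  also have "\<dots> = (\<integral>\<^sup>+X. ennreal ((\<Sum>i<n. g (X i))\<^sup>2) + ennreal (expectation (\<lambda>x. (g x)\<^sup>2)) \<partial>Pi\<^sub>M {..<n} (\<lambda>_. M))"
    by (simp only: second_moment_shift[OF g])
  also have "\<dots> = ennreal (real n * expectation (\<lambda>x. (g x)\<^sup>2)) + ennreal (expectation (\<lambda>x. (g x)\<^sup>2))"
    by (subst nn_integral_add) (auto simp: Suc.IH prob_space.emeasure_space_1[OF Pn])
  finally show ?case by (simp add: algebra_simps flip: ennreal_plus)
qed simp

text \<open>\<open>ennreal\<close> cuts off the negative part of \<open>f\<close>. This is needed
  because the linear lower bound for the likelihood ratio can be negative.\<close>

lemma ennreal_integral_le_nn_integral: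
  fixes f :: "'a \<Rightarrow> real"
  assumes "integrable M f"
  shows "ennreal (\<integral>x. f x \<partial>M) \<le> (\<integral>\<^sup>+x. ennreal (f x) \<partial>M)"
proof -
  have "ennreal (\<integral>x. f x \<partial>M) \<le> ennreal (\<integral>x. max 0 (f x) \<partial>M)"
    using assms by (intro ennreal_leI integral_mono) auto
  also have "\<dots> = (\<integral>\<^sup>+x. ennreal (max 0 (f x)) \<partial>M)"
    using assms by (intro nn_integral_eq_integral[symmetric]) auto
  also have "\<dots> = (\<integral>\<^sup>+x. ennreal (f x) \<partial>M)"
    by (intro nn_integral_cong) (auto simp: max_def ennreal_neg)
  finally show ?thesis .
qed

text \<open>The variance is nonnegative, so the squared mean is at most the second moment.\<close>

lemma (in prob_space) mean_ge_of_second_moment: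
  fixes u :: "'a \<Rightarrow> real"
  assumes u[measurable]: "u \<in> borel_measurable M" and a: "0 \<le> a"
    and le: "(\<integral>\<^sup>+x. ennreal ((u x)\<^sup>2) \<partial>M) \<le> ennreal (a\<^sup>2)"
  shows "integrable M u \<and> - a \<le> expectation u"
proof
  have fin: "(\<integral>\<^sup>+x. ennreal ((u x)\<^sup>2) \<partial>M) < \<infinity>"
    using le by (rule le_less_trans) simp
  then have i2: "integrable M (\<lambda>x. (u x)\<^sup>2)"
    by (intro integrableI_nonneg) auto
  show i1: "integrable M u"
    using square_integrable_imp_integrable[OF u i2] .
  have "ennreal (expectation (\<lambda>x. (u x)\<^sup>2)) \<le> ennreal (a\<^sup>2)"
    using le nn_integral_eq_integral[OF i2] by simp
  then have "expectation (\<lambda>x. (u x)\<^sup>2) \<le> a\<^sup>2" by simp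
  moreover have "(expectation u)\<^sup>2 \<le> expectation (\<lambda>x. (u x)\<^sup>2)"
    using variance_eq[OF i1 i2] variance_positive[of u] by simp
  ultimately have "(- expectation u)\<^sup>2 \<le> a\<^sup>2" by simp
  then have "- expectation u \<le> a" using a by (rule power2_le_imp_le)
  then show "- a \<le> expectation u" by simp
qed

text \<open>For each \<open>p\<close> in \<open>B\<close> the log-likelihood ratio deviates from its
  mean by at most \<open>n e\<^sup>2\<close> in second moment. By Fubini the same holds on average
  over the prior conditioned on \<open>B\<close>, so Chebyshev's inequality for this average yields
  one exceptional set \<open>G\<close> that serves all of \<open>B\<close>.\<close>

lemma evidence_bound:
  assumes p0: "p0 \<in> densities M" and N: "model_prior M N"
    and B: "B \<in> sets N" "0 < measure N B" "B \<subseteq> KL_nbhd M p0 (space N) e"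
    and n: "n \<ge> 1" and e: "0 < e"
  shows "\<exists>G\<in>sets (sample_law M p0 n). emeasure (sample_law M p0 n) G \<le> ennreal (1 / (real n * e\<^sup>2)) \<and>
    (\<forall>X\<in>space (sample_law M p0 n) - G.
      ennreal (measure N B * exp (- 2 * real n * e\<^sup>2)) \<le> (\<integral>\<^sup>+p\<in>B. ennreal (\<Prod>i<n. p (X i) / p0 (X i)) \<partial>N))"
proof -
  define Q where "Q = sample_law M p0 n"
  define P0 where "P0 = law M p0"
  define a where "a = real n * e\<^sup>2"
  have a: "0 < a" using n e by (simp add: a_def)
  interpret N: prob_space N by (rule model_prior_prob_space[OF N])
  interpret Q: prob_space Q unfolding Q_def by (rule prob_space_sample_law[OF p0])
  interpret P0: prob_space P0 unfolding P0_def by (rule prob_space_law[OF p0])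
  have sets_P0[measurable_cong, simp]: "sets P0 = sets M" by (simp add: P0_def)
  define U where "U = uniform_measure N B"
  have sets_U[measurable_cong, simp]: "sets U = sets N" and space_U[simp]: "space U = space N" by (simp_all add: U_def)
  have U: "prob_space U"
    unfolding U_def using B by (intro prob_space_uniform_measure) (auto simp: N.emeasure_eq_measure)
  interpret U: prob_space U by (rule U)
  interpret QU: pair_prob_space Q U ..
  have U_B: "AE p in U. p \<in> B"
    unfolding U_def using B by (intro AE_uniform_measureI) auto
  have R: "(\<lambda>(X, p). p (X i) / p0 (X i)) \<in> borel_measurable (Q \<Otimes>\<^sub>M U)" if "i < n" for i
    using likelihood_ratio_coordinate_measurable[OF p0 N that] unfolding Q_def
    by (simp cong: measurable_cong_sets sets_pair_measure_cong)
  note [measurable] = densities_measurable[OF p0]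
  define Z where "Z p x = ln (p x / p0 x)" for p :: "'a \<Rightarrow> real" and x
  define \<kappa> where "\<kappa> p = (\<integral>x. Z p x \<partial>P0)" for p
  have \<kappa>_m[measurable]: "\<kappa> \<in> borel_measurable U"
  proof -
    have "(\<lambda>(p, x). p x) \<in> borel_measurable (N \<Otimes>\<^sub>M M)"
      using measurable_pair_swap[OF model_prior_measurable[OF N]] by (simp add: case_prod_beta')
    then have [measurable]: "(\<lambda>(p, x). p x) \<in> borel_measurable (U \<Otimes>\<^sub>M P0)"
      by (simp cong: measurable_cong_sets sets_pair_measure_cong)
    show ?thesis unfolding \<kappa>_def Z_def by measurable
  qed
  have R': "(\<lambda>z. snd z (fst z i) / p0 (fst z i)) \<in> borel_measurable (Q \<Otimes>\<^sub>M U)" if "i < n" for i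
    using R[OF that] by (simp only: case_prod_beta')
  have \<kappa>_snd: "(\<lambda>z. \<kappa> (snd z)) \<in> borel_measurable (Q \<Otimes>\<^sub>M U)"
    by (rule measurable_compose[OF measurable_snd \<kappa>_m])
  define pos where "pos X p \<longleftrightarrow> (\<forall>i<n. 0 < p (X i) / p0 (X i))" for X :: "nat \<Rightarrow> 'a" and p
  define u where "u X p = (\<Sum>i<n. Z p (X i) - \<kappa> p)" for X :: "nat \<Rightarrow> 'a" and p
  have u_m[measurable]: "(\<lambda>(X, p). u X p) \<in> borel_measurable (Q \<Otimes>\<^sub>M U)"
  proof -
    have "(\<lambda>z. \<Sum>i<n. ln (snd z (fst z i) / p0 (fst z i)) - \<kappa> (snd z)) \<in> borel_measurable (Q \<Otimes>\<^sub>M U)"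
      by (intro borel_measurable_sum borel_measurable_diff borel_measurable_ln R' \<kappa>_snd) simp
    then show ?thesis by (simp only: u_def Z_def case_prod_beta')
  qed
  have pos_m[measurable]: "Measurable.pred (Q \<Otimes>\<^sub>M U) (\<lambda>(X, p). pos X p)"
  proof -
    have "Measurable.pred (Q \<Otimes>\<^sub>M U) (\<lambda>z. \<forall>i\<in>{..<n}. 0 < snd z (fst z i) / p0 (fst z i))"
    proof (rule pred_intros_finite(3))
      fix i assume "i \<in> {..<n}"
      then have [measurable]: "(\<lambda>z. snd z (fst z i) / p0 (fst z i)) \<in> borel_measurable (Q \<Otimes>\<^sub>M U)"
        by (intro R') simp
      show "Measurable.pred (Q \<Otimes>\<^sub>M U) (\<lambda>z. 0 < snd z (fst z i) / p0 (fst z i))" by measurable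
    qed simp
    then show ?thesis by (simp only: pos_def case_prod_beta' Ball_def lessThan_iff)
  qed
  \<comment> \<open>If some ratio is 0, the true logarithm is minus infinity, whereas
    \<open>ln 0 = 0\<close> would leave \<open>u\<close> finite. The value
    \<open>\<infinity>\<close> ensures that a finite average of \<open>W\<close> excludes such
    \<open>p\<close> almost surely.\<close>
  define W where "W X p = (if pos X p then ennreal ((u X p)\<^sup>2) else \<infinity>)" for X p
  have W_m[measurable]: "(\<lambda>(X, p). W X p) \<in> borel_measurable (Q \<Otimes>\<^sub>M U)"
    unfolding W_def by measurable
  define V where "V X = (\<integral>\<^sup>+p. W X p \<partial>U)" for X
  have V_m[measurable]: "V \<in> borel_measurable Q" unfolding V_def by measurable
  have W_B: "(\<integral>\<^sup>+X. W X p \<partial>Q) \<le> ennreal a" if p: "p \<in> B" for p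
  proof -
    have pN: "p \<in> space N" and p_pos: "AE x in P0. 0 < p x" and i2: "integrable P0 (\<lambda>x. (Z p x)\<^sup>2)"
      and z2: "(\<integral>x. (Z p x)\<^sup>2 \<partial>P0) \<le> e\<^sup>2"
      using p B(3) unfolding P0_def Z_def by (auto simp: KL_nbhd_def)
    note [measurable] = densities_measurable[OF model_prior_densities[OF N pN]]
    have Zm[measurable]: "Z p \<in> borel_measurable P0" unfolding Z_def by measurable
    have i1: "integrable P0 (Z p)" using P0.square_integrable_imp_integrable[OF Zm i2] .
    define g where "g x = Z p x - \<kappa> p" for x
    have g: "integrable P0 g" "P0.expectation g = 0"
      using i1 unfolding g_def[abs_def] \<kappa>_def by (simp_all add: P0.prob_space)
    have gsq: "(g x)\<^sup>2 = (Z p x)\<^sup>2 - 2 * \<kappa> p * Z p x + (\<kappa> p)\<^sup>2" for x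
      by (simp add: g_def power2_diff algebra_simps)
    have g2: "integrable P0 (\<lambda>x. (g x)\<^sup>2)" unfolding gsq using i1 i2 by simp
    have "P0.expectation (\<lambda>x. (g x)\<^sup>2) = P0.variance (Z p)" by (simp add: g_def \<kappa>_def)
    also have "\<dots> \<le> e\<^sup>2" using P0.variance_eq[OF i1 i2] z2 by (smt (verit) zero_le_power2)
    finally have v: "P0.expectation (\<lambda>x. (g x)\<^sup>2) \<le> e\<^sup>2" .
    have "AE X in Q. \<forall>i\<in>{..<n}. 0 < p (X i) / p0 (X i)"
    proof (rule AE_finite_allI)
      fix i assume i: "i \<in> {..<n}"
      have "AE x in P0. 0 < p x / p0 x"
        using p_pos AE_law_pos[OF p0] unfolding P0_def by eventually_elim simp
      then show "AE X in Q. 0 < p (X i) / p0 (X i)"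
        unfolding Q_def sample_law_def using i P0.prob_space_axioms unfolding P0_def
        by (intro AE_PiM_component) auto
    qed simp
    then have "AE X in Q. W X p = ennreal ((\<Sum>i<n. g (X i))\<^sup>2)"
      by eventually_elim (auto simp: W_def pos_def u_def g_def)
    then have "(\<integral>\<^sup>+X. W X p \<partial>Q) = (\<integral>\<^sup>+X. ennreal ((\<Sum>i<n. g (X i))\<^sup>2) \<partial>Q)"
      by (rule nn_integral_cong_AE)
    also have "\<dots> = ennreal (real n * P0.expectation (\<lambda>x. (g x)\<^sup>2))"
      unfolding Q_def sample_law_def P0_def[symmetric] by (rule P0.second_moment_sum[OF g(1) g2 g(2)])
    also have "\<dots> \<le> ennreal a"
      unfolding a_def using v by (intro ennreal_leI mult_left_mono) auto
    finally show ?thesis .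
  qed
  have "(\<integral>\<^sup>+X. V X \<partial>Q) = (\<integral>\<^sup>+p. \<integral>\<^sup>+X. W X p \<partial>Q \<partial>U)"
    unfolding V_def using W_m by (intro QU.Fubini'[symmetric]) simp
  also have "\<dots> \<le> (\<integral>\<^sup>+p. ennreal a \<partial>U)"
    using U_B W_B by (intro nn_integral_mono_AE) (auto elim: AE_mp)
  finally have V: "(\<integral>\<^sup>+X. V X \<partial>Q) \<le> ennreal a" by (simp add: U.emeasure_space_1[unfolded space_U])
  \<comment> \<open>\<open>V\<close> has mean at most \<open>a\<close>, so the threshold
    \<open>a\<^sup>2\<close> gives probability at most \<open>1 / a\<close>. Off \<open>G\<close>
    the mean of \<open>u\<close> is at least \<open>- a\<close>, of the same size as the bound on
    the Kullback-Leibler drift.\<close>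
  define G where "G = {X \<in> space Q. 1 \<le> ennreal (1 / a\<^sup>2) * V X}"
  have G_sets: "G \<in> sets Q" unfolding G_def by measurable
  have "emeasure Q G \<le> ennreal (1 / a\<^sup>2) * (\<integral>\<^sup>+X. V X \<partial>Q)"
    unfolding G_def
    using nn_integral_Markov_inequality[where M=Q and A="space Q" and u=V and c="ennreal (1 / a\<^sup>2)"]
    by (simp add: nn_set_integral_space)
  also have "\<dots> \<le> ennreal (1 / a\<^sup>2) * ennreal a" by (intro mult_left_mono V) auto
  also have "\<dots> = ennreal (1 / a)" using a by (simp flip: ennreal_mult add: power2_eq_square)
  finally have G_small: "emeasure Q G \<le> ennreal (1 / a)" .
  have good: "ennreal (measure N B * exp (- 2 * a)) \<le> (\<integral>\<^sup>+p\<in>B. ennreal (\<Prod>i<n. p (X i) / p0 (X i)) \<partial>N)"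
    if X: "X \<in> space Q - G" for X
  proof -
    have XQ: "X \<in> space Q" using X by auto
    have Wx[measurable]: "W X \<in> borel_measurable U" using measurable_Pair2[OF W_m XQ] by simp
    have ux[measurable]: "u X \<in> borel_measurable U" using measurable_Pair2[OF u_m XQ] by simp
    have Rx[measurable]: "(\<lambda>p. p (X i) / p0 (X i)) \<in> borel_measurable N" if "i < n" for i
      using measurable_Pair2[OF R[OF that] XQ] by simp
    have "ennreal (1 / a\<^sup>2) * V X \<le> 1" using X by (auto simp: G_def not_le)
    then have "ennreal (a\<^sup>2) * (ennreal (1 / a\<^sup>2) * V X) \<le> ennreal (a\<^sup>2) * 1" by (rule mult_left_mono) simp
    then have Vx: "V X \<le> ennreal (a\<^sup>2)" using a by (simp flip: mult.assoc ennreal_mult)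
    then have "V X \<noteq> \<infinity>" by (metis ennreal_less_top infinity_ennreal_def leD)
    then have "AE p in U. W X p \<noteq> \<infinity>"
      unfolding V_def by (intro nn_integral_PInf_AE) auto
    then have pos: "AE p in U. pos X p" by eventually_elim (auto simp: W_def split: if_splits)
    have "(\<integral>\<^sup>+p. ennreal ((u X p)\<^sup>2) \<partial>U) = V X"
      unfolding V_def using pos by (intro nn_integral_cong_AE) (auto simp: W_def elim: AE_mp)
    then have u: "integrable U (u X)" "- a \<le> U.expectation (u X)"
      using U.mean_ge_of_second_moment[OF ux, of a] a Vx by auto
    \<comment> \<open>In place of Jensen's inequality, \<open>exp y \<ge> 1 + y\<close> is used at
      \<open>y = u X p + a\<close>. Of the exponent \<open>2 * a\<close>, one \<open>a\<close> pays
      for the drift \<open>n * \<kappa> p\<close> and one for the deviation of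
      \<open>u\<close>.\<close>
    have "exp (- 2 * a) \<le> exp (- 2 * a) * (1 + U.expectation (u X) + a)" using u(2) by simp
    also have "\<dots> = (\<integral>p. exp (- 2 * a) * (1 + u X p + a) \<partial>U)"
      using u(1) by (simp add: U.prob_space[unfolded space_U])
    finally have "ennreal (exp (- 2 * a)) \<le> ennreal (\<integral>p. exp (- 2 * a) * (1 + u X p + a) \<partial>U)"
      by (rule ennreal_leI)
    also have "\<dots> \<le> (\<integral>\<^sup>+p. ennreal (exp (- 2 * a) * (1 + u X p + a)) \<partial>U)"
      using u(1) by (intro ennreal_integral_le_nn_integral) auto
    also have "\<dots> \<le> (\<integral>\<^sup>+p. ennreal (\<Prod>i<n. p (X i) / p0 (X i)) \<partial>U)"
    proof (rule nn_integral_mono_AE)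
      show "AE p in U. ennreal (exp (- 2 * a) * (1 + u X p + a)) \<le> ennreal (\<Prod>i<n. p (X i) / p0 (X i))"
        using pos U_B
      proof eventually_elim
        fix p assume pos: "pos X p" and p: "p \<in> B"
        have \<kappa>: "- \<kappa> p \<le> e\<^sup>2" using p B(3) by (auto simp: KL_nbhd_def P0_def Z_def \<kappa>_def)
        have "(\<Prod>i<n. p (X i) / p0 (X i)) = (\<Prod>i<n. exp (Z p (X i)))"
          using pos by (intro prod.cong) (auto simp: pos_def Z_def)
        also have "\<dots> = exp (u X p + real n * \<kappa> p)"
          by (simp add: u_def exp_sum[symmetric] sum_subtractf)
        also have "\<dots> \<ge> exp (u X p - a)"
          using mult_left_mono[OF \<kappa>, of "real n"] by (simp add: a_def)
        also have "exp (u X p - a) = exp (- 2 * a) * exp (u X p + a)" by (simp flip: exp_add)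
        also have "\<dots> \<ge> exp (- 2 * a) * (1 + u X p + a)"
          using exp_ge_add_one_self[of "u X p + a"] by (intro mult_left_mono) (linarith, simp)
        finally show "ennreal (exp (- 2 * a) * (1 + u X p + a)) \<le> ennreal (\<Prod>i<n. p (X i) / p0 (X i))"
          by (rule ennreal_leI)
      qed
    qed
    also have "\<dots> = (\<integral>\<^sup>+p\<in>B. ennreal (\<Prod>i<n. p (X i) / p0 (X i)) \<partial>N) / emeasure N B"
      unfolding U_def using B by (intro nn_integral_uniform_measure) auto
    finally have "ennreal (measure N B) * ennreal (exp (- 2 * a))
      \<le> ennreal (measure N B) * ((\<integral>\<^sup>+p\<in>B. ennreal (\<Prod>i<n. p (X i) / p0 (X i)) \<partial>N) / ennreal (measure N B))"
      by (intro mult_left_mono) (auto simp: N.emeasure_eq_measure)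
    also have "\<dots> = (\<integral>\<^sup>+p\<in>B. ennreal (\<Prod>i<n. p (X i) / p0 (X i)) \<partial>N)"
      using B(2) mult_divide_eq_ennreal[of "ennreal (measure N B)" "\<integral>\<^sup>+p\<in>B. ennreal (\<Prod>i<n. p (X i) / p0 (X i)) \<partial>N"]
      by (simp add: ennreal_times_divide mult.commute[of _ "\<integral>\<^sup>+p\<in>B. _ p \<partial>N"])
    finally show ?thesis by (simp add: ennreal_mult)
  qed
  show ?thesis
    using G_sets G_small good unfolding Q_def a_def by (intro bexI[of _ G]) (auto simp: mult.assoc)
qed

section \<open>Likelihood ratios averaged over a model\<close>

text \<open>Sums over models become integrals against counting measure, so that Fubini and the
  arithmetic of nonnegative integrals apply to them.\<close>

lemma infsum_eq_nn_integral_count_space: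
  fixes f :: "'i \<Rightarrow> ennreal"
  assumes "countable A"
  shows "infsum f A = (\<integral>\<^sup>+x. f x \<partial>count_space A)"
proof (rule antisym)
  have "infsum f A = (SUP F\<in>{F. finite F \<and> F \<subseteq> A}. sum f F)"
    by (rule nonneg_infsum_complete) simp
  also have "\<dots> \<le> (\<integral>\<^sup>+x. f x \<partial>count_space A)"
  proof (rule SUP_least)
    fix F assume "F \<in> {F. finite F \<and> F \<subseteq> A}"
    then have F: "finite F" "F \<subseteq> A" by auto
    then have "sum f F = (\<integral>\<^sup>+x. f x * indicator F x \<partial>count_space A)"
      by (subst nn_integral_count_space'[where A=F]) (auto simp: indicator_def intro!: sum.cong)
    also have "\<dots> \<le> (\<integral>\<^sup>+x. f x \<partial>count_space A)"
      by (intro nn_integral_mono) (auto simp: indicator_def)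
    finally show "sum f F \<le> (\<integral>\<^sup>+x. f x \<partial>count_space A)" .
  qed
  finally show "infsum f A \<le> (\<integral>\<^sup>+x. f x \<partial>count_space A)" .
  show "(\<integral>\<^sup>+x. f x \<partial>count_space A) \<le> infsum f A"
  proof (cases "finite A")
    case True
    then show ?thesis by (simp add: nn_integral_count_space_finite)
  next
    case False
    let ?g = "from_nat_into A"
    have g: "bij_betw ?g UNIV A" using assms False by (rule bij_betw_from_nat_into)
    have "(\<integral>\<^sup>+x. f x \<partial>count_space A) = (\<integral>\<^sup>+n. f (?g n) \<partial>count_space UNIV)"
      using nn_integral_bij_count_space[OF g, of f] by simp
    also have "\<dots> = (\<Sum>n. f (?g n))" by (rule nn_integral_count_space_nat)
    also have "\<dots> = (SUP n. \<Sum>i<n. f (?g i))" by (rule suminf_eq_SUP)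
    also have "\<dots> \<le> infsum f A"
    proof (rule SUP_least)
      fix n
      have "(\<Sum>i<n. f (?g i)) = sum f (?g ` {..<n})"
        using g by (subst sum.reindex) (auto simp: bij_betw_def intro: inj_on_subset)
      also have "\<dots> \<le> (SUP F\<in>{F. finite F \<and> F \<subseteq> A}. sum f F)"
        using g by (intro SUP_upper) (auto simp: bij_betw_def)
      also have "\<dots> = infsum f A"
        by (rule nonneg_infsum_complete[symmetric]) simp
      finally show "(\<Sum>i<n. f (?g i)) \<le> infsum f A" .
    qed
    finally show ?thesis .
  qed
qed

text \<open>The marginal likelihood restricted to \<open>S\<close>, relative to \<open>p0\<close>.
  The normalisation cancels in the posterior and makes the expectation under the sample law at most
  the prior mass of \<open>S\<close>.\<close>

definition mean_ratio :: "('x \<Rightarrow> real) \<Rightarrow> ('x \<Rightarrow> real) measure \<Rightarrow> nat \<Rightarrow> ('x \<Rightarrow> real) set \<Rightarrow> (nat \<Rightarrow> 'x) \<Rightarrow> ennreal"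
  where "mean_ratio p0 N n S X = (\<integral>\<^sup>+p\<in>S. ennreal (\<Prod>i<n. p (X i) / p0 (X i)) \<partial>N)"

lemma mean_ratio_measurable:
  assumes p0: "p0 \<in> densities M" and N: "model_prior M N" and S: "S \<in> sets N"
  shows "mean_ratio p0 N n S \<in> borel_measurable (sample_law M p0 n)"
proof -
  interpret N: prob_space N by (rule model_prior_prob_space[OF N])
  note [measurable] = likelihood_ratio_measurable[OF p0 N, of n] S
  show ?thesis unfolding mean_ratio_def[abs_def] by measurable
qed

lemma AE_sample_law_pos:
  assumes p0: "p0 \<in> densities M"
  shows "AE X in sample_law M p0 n. \<forall>i\<in>{..<n}. 0 < p0 (X i)"
proof (rule AE_finite_allI)
  fix i assume "i \<in> {..<n}"
  then show "AE X in sample_law M p0 n. 0 < p0 (X i)"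
    unfolding sample_law_def by (intro AE_PiM_component prob_space_law[OF p0] AE_law_pos[OF p0]) auto
qed simp

lemma weighted_likelihood_eq:
  assumes p0: "p0 \<in> densities M" and A: "countable A" and N: "\<And>\<alpha>. \<alpha> \<in> A \<Longrightarrow> model_prior M (\<pi> \<alpha>)"
    and S: "\<And>\<alpha>. \<alpha> \<in> A \<Longrightarrow> S \<inter> space (\<pi> \<alpha>) \<in> sets (\<pi> \<alpha>)"
    and X: "X \<in> space (sample_law M p0 n)" "\<forall>i\<in>{..<n}. 0 < p0 (X i)"
  shows "weighted_likelihood A w \<pi> n S X =
    ennreal (\<Prod>i<n. p0 (X i)) * (\<integral>\<^sup>+\<alpha>. ennreal (w \<alpha>) * mean_ratio p0 (\<pi> \<alpha>) n (S \<inter> space (\<pi> \<alpha>)) X \<partial>count_space A)"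
proof -
  have pos: "0 < (\<Prod>i<n. p0 (X i))" using X(2) by (intro prod_pos) auto
  have eq: "(\<integral>\<^sup>+ p\<in>S. ennreal (\<Prod>i<n. p (X i)) \<partial>\<pi> \<alpha>) = ennreal (\<Prod>i<n. p0 (X i)) * mean_ratio p0 (\<pi> \<alpha>) n (S \<inter> space (\<pi> \<alpha>)) X"
    if \<alpha>: "\<alpha> \<in> A" for \<alpha>
  proof -
    have m: "(\<lambda>p. \<Prod>i<n. p (X i) / p0 (X i)) \<in> borel_measurable (\<pi> \<alpha>)"
      using measurable_Pair2[OF likelihood_ratio_measurable[OF p0 N[OF \<alpha>]] X(1)] by simp
    have "ennreal (\<Prod>i<n. p0 (X i)) * mean_ratio p0 (\<pi> \<alpha>) n (S \<inter> space (\<pi> \<alpha>)) X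
      = (\<integral>\<^sup>+ p. ennreal (\<Prod>i<n. p0 (X i)) * (ennreal (\<Prod>i<n. p (X i) / p0 (X i)) * indicator (S \<inter> space (\<pi> \<alpha>)) p) \<partial>\<pi> \<alpha>)"
      unfolding mean_ratio_def using m S[OF \<alpha>]
      by (intro nn_integral_cmult[symmetric] borel_measurable_times_ennreal borel_measurable_indicator
          measurable_compose[OF m measurable_ennreal])
    also have "\<dots> = (\<integral>\<^sup>+ p\<in>S. ennreal (\<Prod>i<n. p (X i)) \<partial>\<pi> \<alpha>)"
    proof (rule nn_integral_cong)
      fix p assume p: "p \<in> space (\<pi> \<alpha>)"
      have p_nn: "0 \<le> p (X i)" if "i < n" for i
        using densities_nonneg[OF model_prior_densities[OF N[OF \<alpha>] p]] sample_law_space[OF X(1) that] by auto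
      have p0_pos: "0 < p0 (X i)" if "i < n" for i using X(2) that by auto
      have "0 \<le> (\<Prod>i<n. p (X i) / p0 (X i))"
        using p_nn p0_pos by (intro prod_nonneg divide_nonneg_pos) auto
      moreover have "(\<Prod>i<n. p (X i)) = (\<Prod>i<n. p0 (X i)) * (\<Prod>i<n. p (X i) / p0 (X i))"
        unfolding prod.distrib[symmetric] using p0_pos by (intro prod.cong) (auto simp: less_imp_neq[THEN not_sym])
      ultimately have "ennreal (\<Prod>i<n. p0 (X i)) * ennreal (\<Prod>i<n. p (X i) / p0 (X i)) = ennreal (\<Prod>i<n. p (X i))"
        using pos ennreal_mult[of "\<Prod>i<n. p0 (X i)" "\<Prod>i<n. p (X i) / p0 (X i)"] by (simp only: less_imp_le)
      then show "ennreal (\<Prod>i<n. p0 (X i)) * (ennreal (\<Prod>i<n. p (X i) / p0 (X i)) * indicator (S \<inter> space (\<pi> \<alpha>)) p)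
        = ennreal (\<Prod>i<n. p (X i)) * indicator S p"
        using p by (simp add: indicator_def)
    qed
    finally show ?thesis by simp
  qed
  have "weighted_likelihood A w \<pi> n S X
    = (\<integral>\<^sup>+\<alpha>. ennreal (w \<alpha>) * (\<integral>\<^sup>+ p\<in>S. ennreal (\<Prod>i<n. p (X i)) \<partial>\<pi> \<alpha>) \<partial>count_space A)"
    unfolding weighted_likelihood_def by (rule infsum_eq_nn_integral_count_space[OF A])
  also have "\<dots> = (\<integral>\<^sup>+\<alpha>. ennreal (\<Prod>i<n. p0 (X i)) * (ennreal (w \<alpha>) * mean_ratio p0 (\<pi> \<alpha>) n (S \<inter> space (\<pi> \<alpha>)) X) \<partial>count_space A)"
    by (intro nn_integral_cong) (simp add: eq mult.left_commute)
  also have "\<dots> = ennreal (\<Prod>i<n. p0 (X i)) * (\<integral>\<^sup>+\<alpha>. ennreal (w \<alpha>) * mean_ratio p0 (\<pi> \<alpha>) n (S \<inter> space (\<pi> \<alpha>)) X \<partial>count_space A)"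
    by (intro nn_integral_cmult) simp
  finally show ?thesis .
qed

lemma mean_ratio_mono: "S \<subseteq> S' \<Longrightarrow> mean_ratio p0 N n S X \<le> mean_ratio p0 N n S' X"
  unfolding mean_ratio_def by (intro nn_integral_mono mult_left_mono) (auto simp: indicator_def)

text \<open>By Tonelli it is enough that \<open>p / p0\<close> has mean at most one under the law of
  \<open>p0\<close>; the mean can be smaller, since \<open>p\<close> may have mass where
  \<open>p0\<close> vanishes.\<close>

lemma nn_integral_mean_ratio_le:
  assumes p0: "p0 \<in> densities M" and N: "model_prior M N" and S: "S \<in> sets N"
  shows "(\<integral>\<^sup>+X. mean_ratio p0 N n S X \<partial>sample_law M p0 n) \<le> emeasure N S"
proof -
  interpret N: prob_space N by (rule model_prior_prob_space[OF N])
  interpret Q: prob_space "sample_law M p0 n" by (rule prob_space_sample_law[OF p0])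
  interpret P: prob_space "law M p0" by (rule prob_space_law[OF p0])
  interpret QN: pair_prob_space "sample_law M p0 n" N ..
  interpret PP: product_prob_space "\<lambda>_::nat. law M p0" "{..<n}" ..
  note Lm[measurable] = likelihood_ratio_measurable[OF p0 N, of n]
  note [measurable] = densities_measurable[OF p0] S
  have one: "(\<integral>\<^sup>+X. ennreal (\<Prod>i<n. p (X i) / p0 (X i)) \<partial>sample_law M p0 n) \<le> 1" if p: "p \<in> space N" for p
  proof -
    have pd: "p \<in> densities M" by (rule model_prior_densities[OF N p])
    note [measurable] = densities_measurable[OF pd]
    have "(\<integral>\<^sup>+x. ennreal (p x / p0 x) \<partial>law M p0) = (\<integral>\<^sup>+x. ennreal (p0 x) * ennreal (p x / p0 x) \<partial>M)"
      by (intro nn_integral_law[OF p0]) measurable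
    also have "\<dots> \<le> (\<integral>\<^sup>+x. ennreal (p x) \<partial>M)"
    proof (rule nn_integral_mono)
      fix x assume x: "x \<in> space M"
      show "ennreal (p0 x) * ennreal (p x / p0 x) \<le> ennreal (p x)"
        using densities_nonneg[OF p0 x] densities_nonneg[OF pd x]
        by (cases "p0 x = 0") (simp_all flip: ennreal_mult)
    qed
    also have "\<dots> = 1" by (rule densities_nn_integral[OF pd])
    finally have le1: "(\<integral>\<^sup>+x. ennreal (p x / p0 x) \<partial>law M p0) \<le> 1" .
    have "(\<integral>\<^sup>+X. ennreal (\<Prod>i<n. p (X i) / p0 (X i)) \<partial>sample_law M p0 n)
        = (\<integral>\<^sup>+X. (\<Prod>i<n. ennreal (p (X i) / p0 (X i))) \<partial>sample_law M p0 n)"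
      using sample_law_space[of _ M p0 n] densities_nonneg[OF p0] densities_nonneg[OF pd]
      by (intro nn_integral_cong prod_ennreal[symmetric]) auto
    also have "\<dots> = (\<Prod>i<n. \<integral>\<^sup>+x. ennreal (p x / p0 x) \<partial>law M p0)"
      unfolding sample_law_def by (intro PP.product_nn_integral_prod) auto
    also have "\<dots> \<le> 1"
    proof (induction n)
      case (Suc n)
      then show ?case using mult_mono[OF Suc le1] by (simp add: mult.commute)
    qed simp
    finally show ?thesis .
  qed
  have "(\<integral>\<^sup>+X. mean_ratio p0 N n S X \<partial>sample_law M p0 n)
      = (\<integral>\<^sup>+p. \<integral>\<^sup>+X. ennreal (\<Prod>i<n. p (X i) / p0 (X i)) * indicator S p \<partial>sample_law M p0 n \<partial>N)"
    unfolding mean_ratio_def by (intro QN.Fubini'[symmetric]) measurable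
  also have "\<dots> \<le> (\<integral>\<^sup>+p. indicator S p \<partial>N)"
  proof (rule nn_integral_mono)
    fix p assume p: "p \<in> space N"
    have [measurable]: "(\<lambda>X. \<Prod>i<n. p (X i) / p0 (X i)) \<in> borel_measurable (sample_law M p0 n)"
      using measurable_Pair1[OF Lm p] by simp
    have "(\<integral>\<^sup>+X. ennreal (\<Prod>i<n. p (X i) / p0 (X i)) * indicator S p \<partial>sample_law M p0 n)
        = (\<integral>\<^sup>+X. ennreal (\<Prod>i<n. p (X i) / p0 (X i)) \<partial>sample_law M p0 n) * indicator S p"
      by (intro nn_integral_multc) measurable
    also have "\<dots> \<le> 1 * indicator S p" by (intro mult_right_mono one p) auto
    finally show "(\<integral>\<^sup>+X. ennreal (\<Prod>i<n. p (X i) / p0 (X i)) * indicator S p \<partial>sample_law M p0 n) \<le> indicator S p"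
      by simp
  qed
  also have "\<dots> = emeasure N S" by simp
  finally show ?thesis .
qed

text \<open>\<open>enat\<close> is well-ordered, so the infimum is attained by an actual cover as
  soon as its logarithm is not \<open>\<infinity>\<close>. The empty cover satisfies the cardinality
  bound trivially.\<close>

lemma covering_number_cover:
  assumes "log_enat (covering_number r S d) \<le> ereal V"
  shows "\<exists>C. finite C \<and> C \<subseteq> S \<and> S \<subseteq> (\<Union>c\<in>C. {q \<in> S. d c q < r}) \<and> real (card C) \<le> exp V"
proof -
  let ?Y = "{F. finite F \<and> F \<subseteq> S \<and> S \<subseteq> (\<Union>c\<in>F. {q \<in> S. d c q < r})}"
  have ne: "covering_number r S d \<noteq> \<infinity>" using assms by (auto simp: log_enat_def split: enat.splits)
  then have "?Y \<noteq> {}" unfolding covering_number_def by (metis Inf_empty image_empty top_enat_def)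
  then obtain C0 where "C0 \<in> ?Y" by blast
  then have "covering_number r S d \<in> (\<lambda>F. enat (card F)) ` ?Y"
    unfolding covering_number_def by (rule wellorder_InfI[OF imageI])
  then obtain C where C: "C \<in> ?Y" "covering_number r S d = enat (card C)" by auto
  have "real (card C) \<le> exp V"
  proof (cases "card C = 0")
    case False
    then have "ln (real (card C)) \<le> V" using assms C(2) by (simp add: log_enat_def)
    then have "exp (ln (real (card C))) \<le> exp V" by simp
    then show ?thesis using False by simp
  qed simp
  then show ?thesis using C(1) by (intro exI[of _ C]) auto
qed

definition shell :: "(('x \<Rightarrow> real) \<Rightarrow> ('x \<Rightarrow> real) \<Rightarrow> real) \<Rightarrow> ('x \<Rightarrow> real) \<Rightarrow> ('x \<Rightarrow> real) measure \<Rightarrow> real \<Rightarrow> nat \<Rightarrow> ('x \<Rightarrow> real) set"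
  where "shell d p0 N s j = {p \<in> space N. real j * s \<le> d p p0 \<and> d p p0 < real (Suc j) * s}"

text \<open>
  Thin shells: the outer radius determines the scale of the covering, so that the covering balls have
  radius \<open>(j + 1) s / 6\<close> and those meeting the shell keep the distance \<open>(2 j - 1) s / 3\<close> from \<open>p0\<close>.
\<close>

lemma shell_sqrt_mean_ratio_le:
  assumes p0: "p0 \<in> densities M" and metric: "density_metric M d" and conv: "convex_balls M d"
    and le_h: "\<And>p q. p \<in> densities M \<Longrightarrow> q \<in> densities M \<Longrightarrow> d p q \<le> hellinger M p q"
    and N: "model_prior M N" and dm: "(\<lambda>p. d p p0) \<in> borel_measurable N"
    and j: "1 \<le> j" and s: "0 < s"
    and ent: "log_enat (covering_number (real (Suc j) * s / 6) (dist_nbhd d p0 (space N) (real (Suc j) * s)) d) \<le> ereal V"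
  shows "(\<integral>\<^sup>+X. ennreal (sqrt (enn2real (mean_ratio p0 N n (shell d p0 N s j) X))) \<partial>sample_law M p0 n)
    \<le> ennreal (sqrt (measure N (shell d p0 N s j)) * exp (V - real n * ((2 * real j - 1) * s / 3)\<^sup>2 / 2))"
proof -
  let ?S = "shell d p0 N s j" and ?r = "real (Suc j) * s / 6" and ?T = "dist_nbhd d p0 (space N) (real (Suc j) * s)"
  define \<delta> where "\<delta> = (2 * real j - 1) * s / 3"
  obtain C where C: "finite C" "C \<subseteq> ?T" "?T \<subseteq> (\<Union>c\<in>C. {q \<in> ?T. d c q < ?r})" "real (card C) \<le> exp V"
    using covering_number_cover[OF ent] by blast
  note dens = model_prior_densities[OF N]
  have T: "?T \<subseteq> densities M" using dens by (auto simp: dist_nbhd_def)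
  have S_T: "?S \<subseteq> ?T" by (auto simp: shell_def dist_nbhd_def)
  note tri = metric[unfolded density_metric_def, THEN conjunct2, rule_format]
  note sym = metric[unfolded density_metric_def, THEN conjunct1, rule_format, THEN conjunct2, THEN conjunct1]
  have "(\<integral>\<^sup>+X. ennreal (sqrt (enn2real (mean_ratio p0 N n ?S X))) \<partial>sample_law M p0 n)
    \<le> ennreal (sqrt (measure N ?S) * (real (card C) * exp (- real n * \<delta>\<^sup>2 / 2)))"
    unfolding mean_ratio_def
  proof (rule sqrt_likelihood_cover[OF p0 conv le_h N _ C(1)])
    show "?S \<in> sets N" unfolding shell_def using dm by measurable
    show "C \<subseteq> densities M" using C(2) T by blast
    \<comment> \<open>The covering balls are enlarged from the model to all densities: convexity
      holds only there, since mixtures of model densities may leave the model.\<close>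
    show "?S \<subseteq> (\<Union>c\<in>C. density_ball M d c ?r)"
    proof
      fix p assume "p \<in> ?S"
      then have "p \<in> ?T" using S_T by auto
      then show "p \<in> (\<Union>c\<in>C. density_ball M d c ?r)"
        using C(3) T by (force simp: density_ball_def)
    qed
    show "0 \<le> \<delta>" using j s by (simp add: \<delta>_def)
    fix c p q assume c: "c \<in> C" and p: "p \<in> ?S" "p \<in> density_ball M d c ?r" and q: "q \<in> density_ball M d c ?r"
    have D: "c \<in> densities M" "p \<in> densities M" "q \<in> densities M"
      using c C(2) T p q by (auto simp: density_ball_def)
    \<comment> \<open>The path from \<open>p\<close> to \<open>q\<close> through the centre costs
      two radii, together \<open>(j + 1) s / 3\<close>, of the inner radius
      \<open>j s\<close>.\<close>
    have "real j * s \<le> d p p0" using p by (simp add: shell_def)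
    also have "\<dots> \<le> d p c + d c p0" by (rule tri[OF D(2,1) p0])
    also have "d c p0 \<le> d c q + d q p0" by (rule tri[OF D(1,3) p0])
    also have "d p c < ?r" using p(2) sym[OF D(2,1)] by (simp add: density_ball_def)
    also have "d c q < ?r" using q by (simp add: density_ball_def)
    finally show "\<delta> \<le> d q p0" by (simp add: \<delta>_def field_simps)
  qed auto
  also have "\<dots> \<le> ennreal (sqrt (measure N ?S) * (exp V * exp (- real n * \<delta>\<^sup>2 / 2)))"
    using C(4) by (intro ennreal_leI mult_left_mono mult_right_mono) auto
  also have "exp V * exp (- real n * \<delta>\<^sup>2 / 2) = exp (V - real n * \<delta>\<^sup>2 / 2)"
    by (simp flip: exp_add)
  finally show ?thesis by (simp add: \<delta>_def)
qed

section \<open>Expectation of the posterior mass\<close>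

lemma ennreal_divide_le_1: "a \<le> b \<Longrightarrow> a / b \<le> (1::ennreal)"
  by (cases "b = 0 \<or> b = top") (auto intro: divide_le_posI_ennreal simp: zero_less_iff_neq_zero)

lemma ennreal_divide_left_mono:
  assumes "ennreal D0 \<le> D" "0 < D0"
  shows "x / D \<le> x / ennreal D0"
proof (cases D)
  case (real D')
  then have "D0 \<le> D'" using assms by (simp add: ennreal_le_iff)
  then show ?thesis
    using real assms(2) unfolding divide_ennreal_def
    by (intro mult_left_mono) (auto simp: inverse_ennreal intro!: ennreal_leI le_imp_inverse_le)
qed simp

text \<open>The order matters: the square root is taken while the quotient is still at most one, and
  only then is \<open>D\<close> replaced by its lower bound \<open>D0\<close>; \<open>r / D0\<close>
  may exceed one.\<close>

lemma ennreal_divide_le_sqrt: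
  assumes "r \<le> D" "ennreal D0 \<le> D" "0 < D0"
  shows "r / D \<le> ennreal (sqrt (enn2real r / D0))"
proof (cases "D = top")
  case False
  then have r: "r < top" using assms(1) by (metis le_less_trans top.not_eq_extremum)
  obtain r' where r': "r = ennreal r'" "0 \<le> r'" using r by (cases r) auto
  obtain D' where D': "D = ennreal D'" "0 \<le> D'" using False by (cases D) auto
  have *: "r' \<le> D'" "D0 \<le> D'" using assms r' D' by (auto simp: ennreal_le_iff)
  then have D'_pos: "0 < D'" using assms(3) by simp
  have "r' / D' \<le> sqrt (r' / D')"
    using * r' D'_pos by (intro real_le_rsqrt) (auto simp: power2_eq_square field_simps intro: mult_mono)
  also have "\<dots> \<le> sqrt (r' / D0)"
    using * r' assms(3) D'_pos by (intro real_sqrt_le_mono divide_left_mono) auto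
  finally have "ennreal (r' / D') \<le> ennreal (sqrt (r' / D0))" by (rule ennreal_leI)
  then show ?thesis using r' D' D'_pos by (simp add: divide_ennreal)
qed simp

text \<open>As a function of the set this is the measure with the likelihood ratio as density with
  respect to the prior.\<close>

lemma mean_ratio_subadditive:
  assumes p0: "p0 \<in> densities M" and N: "model_prior M N" and X: "X \<in> space (sample_law M p0 n)"
    and sub: "S \<subseteq> T \<union> (\<Union>k. U k)" and T: "T \<in> sets N" and U: "\<And>k::nat. U k \<in> sets N"
  shows "mean_ratio p0 N n S X \<le> mean_ratio p0 N n T X + (\<Sum>k. mean_ratio p0 N n (U k) X)"
proof -
  have m: "(\<lambda>p. ennreal (\<Prod>i<n. p (X i) / p0 (X i))) \<in> borel_measurable N"
    using measurable_compose[OF measurable_Pair2[OF likelihood_ratio_measurable[OF p0 N] X] measurable_ennreal]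
    by simp
  let ?\<nu> = "density N (\<lambda>p. ennreal (\<Prod>i<n. p (X i) / p0 (X i)))"
  have eq: "mean_ratio p0 N n R X = emeasure ?\<nu> R" if "R \<in> sets N" for R
    unfolding mean_ratio_def using m that by (simp add: emeasure_density)
  have UU: "(\<Union>k. U k) \<in> sets N" using U by auto
  have "mean_ratio p0 N n S X \<le> mean_ratio p0 N n (T \<union> (\<Union>k. U k)) X" using sub by (rule mean_ratio_mono)
  also have "\<dots> = emeasure ?\<nu> (T \<union> (\<Union>k. U k))" using T UU by (intro eq) auto
  also have "\<dots> \<le> emeasure ?\<nu> T + emeasure ?\<nu> (\<Union>k. U k)"
    using T UU by (intro emeasure_subadditive) auto
  also have "emeasure ?\<nu> (\<Union>k. U k) \<le> (\<Sum>k. emeasure ?\<nu> (U k))"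
    using U by (intro emeasure_subadditive_countably) auto
  finally show ?thesis using T U by (simp add: eq add_left_mono)
qed

lemma borel_measurable_nn_integral_count_space:
  fixes f :: "'i \<Rightarrow> 'a \<Rightarrow> ennreal"
  assumes "countable A" "\<And>i. i \<in> A \<Longrightarrow> f i \<in> borel_measurable M"
  shows "(\<lambda>x. \<integral>\<^sup>+i. f i x \<partial>count_space A) \<in> borel_measurable M"
proof -
  interpret sigma_finite_measure "count_space A"
    using assms(1) by (rule sigma_finite_measure_count_space_countable)
  have "(\<lambda>z. f (fst z) (snd z)) \<in> borel_measurable (count_space A \<Otimes>\<^sub>M M)"
    using assms by (intro measurable_pair_measure_countable1) auto
  from measurable_pair_swap[OF this]
  have "(\<lambda>(x, i). f i x) \<in> borel_measurable (M \<Otimes>\<^sub>M count_space A)"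
    by (simp add: case_prod_beta')
  then show ?thesis by (rule borel_measurable_nn_integral)
qed

text \<open>The nonasymptotic bound. Its terms come from the event of small evidence, the central
  parts \<open>d p p0 \<le> t \<alpha>\<close> of the models in \<open>Cc\<close>, and the shells of
  all models. For \<open>\<alpha>\<close> in \<open>Cc\<close> the radius \<open>t \<alpha>\<close>
  may exceed \<open>r\<close>, so the centre can meet the set and is controlled by prior mass alone.
  For other models \<open>t \<alpha> \<le> r\<close>, and the shells, which start at or below
  \<open>t \<alpha>\<close>, cover everything.\<close>

lemma posterior_expectation_le:
  fixes A :: "'i set" and s t V :: "'i \<Rightarrow> real"
  assumes p0: "p0 \<in> densities M" and metric: "density_metric M d" and conv: "convex_balls M d"
    and le_h: "\<And>p q. p \<in> densities M \<Longrightarrow> q \<in> densities M \<Longrightarrow> d p q \<le> hellinger M p q"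
    and A: "countable A" and w: "\<And>\<alpha>. \<alpha> \<in> A \<Longrightarrow> 0 \<le> w \<alpha>"
    and N: "\<And>\<alpha>. \<alpha> \<in> A \<Longrightarrow> model_prior M (\<pi> \<alpha>)"
    and dm: "\<And>\<alpha>. \<alpha> \<in> A \<Longrightarrow> (\<lambda>p. d p p0) \<in> borel_measurable (\<pi> \<alpha>)"
    and b: "b \<in> A" "0 < w b"
    and B: "B \<in> sets (\<pi> b)" "0 < measure (\<pi> b) B" "B \<subseteq> KL_nbhd M p0 (space (\<pi> b)) e"
    and n: "n \<ge> 1" and e: "0 < e"
    and Cc: "Cc \<subseteq> A" and s: "\<And>\<alpha>. \<alpha> \<in> A \<Longrightarrow> 0 < s \<alpha>" and j0: "1 \<le> j0"
    and t: "\<And>\<alpha>. \<alpha> \<in> A \<Longrightarrow> real j0 * s \<alpha> \<le> t \<alpha>" "\<And>\<alpha>. \<alpha> \<in> A \<Longrightarrow> \<alpha> \<notin> Cc \<Longrightarrow> t \<alpha> \<le> r"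
    and ent: "\<And>\<alpha> j. \<alpha> \<in> A \<Longrightarrow> j0 \<le> j \<Longrightarrow>
      log_enat (covering_number (real (Suc j) * s \<alpha> / 6) (dist_nbhd d p0 (space (\<pi> \<alpha>)) (real (Suc j) * s \<alpha>)) d) \<le> ereal (V \<alpha>)"
  defines "ratio \<equiv> \<lambda>\<alpha> u. w \<alpha> / w b * (measure (\<pi> \<alpha>) (dist_nbhd d p0 (space (\<pi> \<alpha>)) u) / measure (\<pi> b) B)"
  shows "(\<integral>\<^sup>+X. posterior A w \<pi> n {p. r \<le> d p p0} X \<partial>sample_law M p0 n)
    \<le> ennreal (1 / (real n * e\<^sup>2))
      + (\<integral>\<^sup>+\<alpha>. ennreal (ratio \<alpha> (t \<alpha>) * exp (2 * real n * e\<^sup>2)) \<partial>count_space Cc)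
      + (\<integral>\<^sup>+\<alpha>. (\<Sum>k. ennreal (sqrt (ratio \<alpha> (real (Suc (j0 + k)) * s \<alpha>)) *
           exp (real n * e\<^sup>2 + V \<alpha> - real n * ((2 * real (j0 + k) - 1) * s \<alpha> / 3)\<^sup>2 / 2))) \<partial>count_space A)"
proof -
  let ?Q = "sample_law M p0 n" and ?S = "{p. r \<le> d p p0}"
  let ?mr = "\<lambda>\<alpha>. mean_ratio p0 (\<pi> \<alpha>) n"
  let ?T = "\<lambda>\<alpha>. if \<alpha> \<in> Cc then dist_nbhd d p0 (space (\<pi> \<alpha>)) (t \<alpha>) else {}"
  let ?Sh = "\<lambda>\<alpha> k. shell d p0 (\<pi> \<alpha>) (s \<alpha>) (j0 + k)"
  define D0 where "D0 = w b * (measure (\<pi> b) B * exp (- 2 * real n * e\<^sup>2))"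
  have D0: "0 < D0" using b B by (simp add: D0_def)
  obtain G where G: "G \<in> sets ?Q" "emeasure ?Q G \<le> ennreal (1 / (real n * e\<^sup>2))"
    and good: "\<And>X. X \<in> space ?Q - G \<Longrightarrow> ennreal (measure (\<pi> b) B * exp (- 2 * real n * e\<^sup>2)) \<le> ?mr b B X"
    using evidence_bound[OF p0 N[OF b(1)] B n e] unfolding mean_ratio_def by blast
  have dsets: "{p \<in> space (\<pi> \<alpha>). Q (d p p0)} \<in> sets (\<pi> \<alpha>)" if "\<alpha> \<in> A" "Measurable.pred borel Q" for \<alpha> Q
    using dm[OF that(1)] that(2) by measurable
  have S_sets: "?S \<inter> space (\<pi> \<alpha>) \<in> sets (\<pi> \<alpha>)" if "\<alpha> \<in> A" for \<alpha>
    using dsets[OF that, of "\<lambda>u. r \<le> u"] by (simp add: Int_def conj_commute)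
  have T_sets: "?T \<alpha> \<in> sets (\<pi> \<alpha>)" if "\<alpha> \<in> A" for \<alpha>
    using dsets[OF that, of "\<lambda>u. u \<le> t \<alpha>"] by (simp add: dist_nbhd_def)
  have Sh_sets: "?Sh \<alpha> k \<in> sets (\<pi> \<alpha>)" if "\<alpha> \<in> A" for \<alpha> k
    using dsets[OF that, of "\<lambda>u. real (j0 + k) * s \<alpha> \<le> u \<and> u < real (Suc (j0 + k)) * s \<alpha>"]
    by (simp add: shell_def)
  have cover: "?S \<inter> space (\<pi> \<alpha>) \<subseteq> ?T \<alpha> \<union> (\<Union>k. ?Sh \<alpha> k)" if \<alpha>: "\<alpha> \<in> A" for \<alpha>
  proof
    fix p assume p: "p \<in> ?S \<inter> space (\<pi> \<alpha>)"
    show "p \<in> ?T \<alpha> \<union> (\<Union>k. ?Sh \<alpha> k)"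
    proof (cases "p \<in> ?T \<alpha>")
      case False
      then have "t \<alpha> \<le> d p p0"
        using p t(2)[OF \<alpha>] by (auto simp: dist_nbhd_def split: if_splits)
      then have j0_le: "real j0 \<le> d p p0 / s \<alpha>"
        using t(1)[OF \<alpha>] s[OF \<alpha>] by (simp add: field_simps)
      \<comment> \<open>The shell containing \<open>p\<close>; its index is at least
        \<open>j0\<close> because
        \<open>d p p0 \<ge> t \<alpha> \<ge> j0 * s \<alpha>\<close>.\<close>
      define j where "j = nat \<lfloor>d p p0 / s \<alpha>\<rfloor>"
      have "j0 \<le> j" using j0_le unfolding j_def by (simp add: le_nat_floor)
      have jr: "real j = of_int \<lfloor>d p p0 / s \<alpha>\<rfloor>" using j0_le unfolding j_def by simp
      have "real j \<le> d p p0 / s \<alpha>" "d p p0 / s \<alpha> < real (Suc j)"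
        unfolding of_nat_Suc jr by linarith+
      then have "p \<in> shell d p0 (\<pi> \<alpha>) (s \<alpha>) j"
        using p s[OF \<alpha>] by (simp add: shell_def pos_le_divide_eq pos_divide_less_eq)
      then have "p \<in> ?Sh \<alpha> (j - j0)" using \<open>j0 \<le> j\<close> by simp
      then show ?thesis by blast
    qed simp
  qed
  \<comment> \<open>The central part keeps its first moment, since no separation from
    \<open>p0\<close> is available there; the square root is used on the shells only.\<close>
  define f where "f \<alpha> X = ennreal (w \<alpha>) * ?mr \<alpha> (?T \<alpha>) X / ennreal D0
      + (\<Sum>k. ennreal (sqrt (w \<alpha> / D0)) * ennreal (sqrt (enn2real (?mr \<alpha> (?Sh \<alpha> k) X))))" for \<alpha> X
  have mr_m: "?mr \<alpha> R \<in> borel_measurable ?Q" if "\<alpha> \<in> A" "R \<in> sets (\<pi> \<alpha>)" for \<alpha> R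
    using mean_ratio_measurable[OF p0 N[OF that(1)] that(2)] .
  have f_m: "f \<alpha> \<in> borel_measurable ?Q" if \<alpha>: "\<alpha> \<in> A" for \<alpha>
  proof -
    note [measurable] = mr_m[OF \<alpha> T_sets[OF \<alpha>]] mr_m[OF \<alpha> Sh_sets[OF \<alpha>]]
    show ?thesis unfolding f_def[abs_def] by measurable
  qed
  have pointwise: "posterior A w \<pi> n ?S X \<le> indicator G X + (\<integral>\<^sup>+\<alpha>. f \<alpha> X \<partial>count_space A)"
    if X: "X \<in> space ?Q" and pos: "\<forall>i\<in>{..<n}. 0 < p0 (X i)" for X
  proof -
    let ?P = "ennreal (\<Prod>i<n. p0 (X i))"
    define D where "D = (\<integral>\<^sup>+\<alpha>. ennreal (w \<alpha>) * ?mr \<alpha> (space (\<pi> \<alpha>)) X \<partial>count_space A)"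
    have P: "?P \<noteq> 0" "?P \<noteq> \<infinity>" using pos by (auto simp: ennreal_eq_0_iff not_le intro!: prod_pos)
    have "posterior A w \<pi> n ?S X
      = (\<integral>\<^sup>+\<alpha>. ennreal (w \<alpha>) * ?mr \<alpha> (?S \<inter> space (\<pi> \<alpha>)) X \<partial>count_space A) / D"
      unfolding posterior_def D_def
      using weighted_likelihood_eq[where \<pi>=\<pi> and w=w and S="?S", OF p0 A N S_sets X pos]
        weighted_likelihood_eq[where \<pi>=\<pi> and w=w and S=UNIV, OF p0 A N _ X pos]
        divide_mult_eq[OF P]
      by (simp add: mult.commute[of ?P])
    also have "\<dots> = (\<integral>\<^sup>+\<alpha>. ennreal (w \<alpha>) * ?mr \<alpha> (?S \<inter> space (\<pi> \<alpha>)) X / D \<partial>count_space A)"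
      by (intro nn_integral_divide[symmetric]) simp
    finally have post: "posterior A w \<pi> n ?S X = \<dots>" .
    have le_D: "ennreal (w \<alpha>) * ?mr \<alpha> R X \<le> D" if "\<alpha> \<in> A" "R \<subseteq> space (\<pi> \<alpha>)" for \<alpha> R
    proof -
      have "ennreal (w \<alpha>) * ?mr \<alpha> R X \<le> ennreal (w \<alpha>) * ?mr \<alpha> (space (\<pi> \<alpha>)) X"
        by (intro mult_left_mono mean_ratio_mono that) simp
      also have "\<dots> \<le> D" unfolding D_def using that(1) by (rule nn_integral_ge_point)
      finally show ?thesis .
    qed
    show ?thesis
    proof (cases "X \<in> G")
      case True
      \<comment> \<open>On \<open>G\<close> nothing is known about the evidence, and the trivial
        bound is charged to the probability of \<open>G\<close>.\<close>
      have "posterior A w \<pi> n ?S X \<le> 1"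
        unfolding post D_def
        by (subst nn_integral_divide)
          (auto intro!: ennreal_divide_le_1 nn_integral_mono mult_left_mono mean_ratio_mono)
      then show ?thesis using True by (simp add: add_increasing2)
    next
      case False
      then have "ennreal D0 \<le> ennreal (w b) * ?mr b B X"
        using good[of X] X b(2) B(2) unfolding D0_def by (subst ennreal_mult) (auto intro!: mult_left_mono)
      also have "\<dots> \<le> D" using le_D[OF b(1)] sets.sets_into_space[OF B(1)] by blast
      finally have D0_le: "ennreal D0 \<le> D" .
      have "ennreal (w \<alpha>) * ?mr \<alpha> (?S \<inter> space (\<pi> \<alpha>)) X / D \<le> f \<alpha> X" if \<alpha>: "\<alpha> \<in> A" for \<alpha>
      proof -
        have "ennreal (w \<alpha>) * ?mr \<alpha> (?S \<inter> space (\<pi> \<alpha>)) X / D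
          \<le> ennreal (w \<alpha>) * (?mr \<alpha> (?T \<alpha>) X + (\<Sum>k. ?mr \<alpha> (?Sh \<alpha> k) X)) / D"
          by (intro divide_right_mono_ennreal mult_left_mono
              mean_ratio_subadditive[OF p0 N[OF \<alpha>] X cover[OF \<alpha>] T_sets[OF \<alpha>] Sh_sets[OF \<alpha>]]) simp
        also have "\<dots> = ennreal (w \<alpha>) * ?mr \<alpha> (?T \<alpha>) X / D + (\<Sum>k. ennreal (w \<alpha>) * ?mr \<alpha> (?Sh \<alpha> k) X / D)"
          by (simp only: distrib_left add_divide_distrib_ennreal ennreal_suminf_cmult ennreal_suminf_divide)
        also have "\<dots> \<le> f \<alpha> X"
          unfolding f_def
        proof (intro add_mono suminf_le summableI)
          show "ennreal (w \<alpha>) * ?mr \<alpha> (?T \<alpha>) X / D \<le> ennreal (w \<alpha>) * ?mr \<alpha> (?T \<alpha>) X / ennreal D0"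
            using D0_le D0 by (rule ennreal_divide_left_mono)
          fix k
          have "ennreal (w \<alpha>) * ?mr \<alpha> (?Sh \<alpha> k) X / D
            \<le> ennreal (sqrt (enn2real (ennreal (w \<alpha>) * ?mr \<alpha> (?Sh \<alpha> k) X) / D0))"
            using sets.sets_into_space[OF Sh_sets[OF \<alpha>]] by (intro ennreal_divide_le_sqrt le_D \<alpha> D0_le D0)
          also have "\<dots> = ennreal (sqrt (w \<alpha> / D0)) * ennreal (sqrt (enn2real (?mr \<alpha> (?Sh \<alpha> k) X)))"
            using w[OF \<alpha>] D0 by (simp add: enn2real_mult real_sqrt_mult real_sqrt_divide flip: ennreal_mult)
          finally show "ennreal (w \<alpha>) * ?mr \<alpha> (?Sh \<alpha> k) X / D
            \<le> ennreal (sqrt (w \<alpha> / D0)) * ennreal (sqrt (enn2real (?mr \<alpha> (?Sh \<alpha> k) X)))" .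
        qed
        finally show ?thesis .
      qed
      then show ?thesis unfolding post by (auto intro!: add_increasing nn_integral_mono)
    qed
  qed
  have f_int: "(\<integral>\<^sup>+X. f \<alpha> X \<partial>?Q)
    \<le> ennreal (ratio \<alpha> (t \<alpha>) * exp (2 * real n * e\<^sup>2)) * indicator Cc \<alpha>
      + (\<Sum>k. ennreal (sqrt (ratio \<alpha> (real (Suc (j0 + k)) * s \<alpha>)) *
           exp (real n * e\<^sup>2 + V \<alpha> - real n * ((2 * real (j0 + k) - 1) * s \<alpha> / 3)\<^sup>2 / 2)))"
    if \<alpha>: "\<alpha> \<in> A" for \<alpha>
  proof -
    interpret N: prob_space "\<pi> \<alpha>" by (rule model_prior_prob_space[OF N[OF \<alpha>]])
    note m[measurable] = mr_m[OF \<alpha> T_sets[OF \<alpha>]] mr_m[OF \<alpha> Sh_sets[OF \<alpha>]]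
    have eexp: "exp (2 * real n * e\<^sup>2) = (exp (real n * e\<^sup>2))\<^sup>2" "exp (- 2 * real n * e\<^sup>2) = 1 / (exp (real n * e\<^sup>2))\<^sup>2"
      by (simp_all add: exp_minus inverse_eq_divide flip: exp_double)
    have ratio_D0: "w \<alpha> * measure (\<pi> \<alpha>) (dist_nbhd d p0 (space (\<pi> \<alpha>)) u) / D0 = ratio \<alpha> u * (exp (real n * e\<^sup>2))\<^sup>2" for u
      unfolding D0_def ratio_def eexp(2) using b B by (simp add: field_simps)
    have "(\<integral>\<^sup>+X. f \<alpha> X \<partial>?Q) = (\<integral>\<^sup>+X. ennreal (w \<alpha>) * ?mr \<alpha> (?T \<alpha>) X / ennreal D0 \<partial>?Q)
      + (\<Sum>k. \<integral>\<^sup>+X. ennreal (sqrt (w \<alpha> / D0)) * ennreal (sqrt (enn2real (?mr \<alpha> (?Sh \<alpha> k) X))) \<partial>?Q)"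
      unfolding f_def by (subst nn_integral_add, measurable) (subst nn_integral_suminf, auto)
    also have "\<dots> \<le> ennreal (ratio \<alpha> (t \<alpha>) * exp (2 * real n * e\<^sup>2)) * indicator Cc \<alpha>
      + (\<Sum>k. ennreal (sqrt (ratio \<alpha> (real (Suc (j0 + k)) * s \<alpha>)) *
           exp (real n * e\<^sup>2 + V \<alpha> - real n * ((2 * real (j0 + k) - 1) * s \<alpha> / 3)\<^sup>2 / 2)))"
    proof (intro add_mono suminf_le summableI)
      have "(\<integral>\<^sup>+X. ennreal (w \<alpha>) * ?mr \<alpha> (?T \<alpha>) X / ennreal D0 \<partial>?Q)
        = ennreal (w \<alpha>) * (\<integral>\<^sup>+X. ?mr \<alpha> (?T \<alpha>) X \<partial>?Q) / ennreal D0"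
        by (simp add: nn_integral_divide nn_integral_cmult)
      also have "\<dots> \<le> ennreal (w \<alpha>) * emeasure (\<pi> \<alpha>) (?T \<alpha>) / ennreal D0"
        by (intro divide_right_mono_ennreal mult_left_mono nn_integral_mean_ratio_le p0 N \<alpha> T_sets) simp
      also have "\<dots> = ennreal (ratio \<alpha> (t \<alpha>) * exp (2 * real n * e\<^sup>2)) * indicator Cc \<alpha>"
        using w[OF \<alpha>] D0 ratio_D0[of "t \<alpha>"]
        by (simp add: N.emeasure_eq_measure divide_ennreal eexp(1) flip: ennreal_mult)
      finally show "(\<integral>\<^sup>+X. ennreal (w \<alpha>) * ?mr \<alpha> (?T \<alpha>) X / ennreal D0 \<partial>?Q)
        \<le> ennreal (ratio \<alpha> (t \<alpha>) * exp (2 * real n * e\<^sup>2)) * indicator Cc \<alpha>" .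
      fix k
      let ?z = "exp (V \<alpha> - real n * ((2 * real (j0 + k) - 1) * s \<alpha> / 3)\<^sup>2 / 2)"
      let ?C = "dist_nbhd d p0 (space (\<pi> \<alpha>)) (real (Suc (j0 + k)) * s \<alpha>)"
      have "?C \<in> sets (\<pi> \<alpha>)"
        using dsets[OF \<alpha>, of "\<lambda>u. u \<le> real (Suc (j0 + k)) * s \<alpha>"] by (simp add: dist_nbhd_def)
      \<comment> \<open>Shells are enlarged to balls because the prior mass conditions are stated
        for balls.\<close>
      then have mono: "measure (\<pi> \<alpha>) (?Sh \<alpha> k) \<le> measure (\<pi> \<alpha>) ?C"
        by (intro N.finite_measure_mono) (auto simp: shell_def dist_nbhd_def)
      have "(\<integral>\<^sup>+X. ennreal (sqrt (w \<alpha> / D0)) * ennreal (sqrt (enn2real (?mr \<alpha> (?Sh \<alpha> k) X))) \<partial>?Q)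
        = ennreal (sqrt (w \<alpha> / D0)) * (\<integral>\<^sup>+X. ennreal (sqrt (enn2real (?mr \<alpha> (?Sh \<alpha> k) X))) \<partial>?Q)"
        by (intro nn_integral_cmult) measurable
      also have "\<dots> \<le> ennreal (sqrt (w \<alpha> / D0)) * ennreal (sqrt (measure (\<pi> \<alpha>) (?Sh \<alpha> k)) * ?z)"
        using j0 by (intro mult_left_mono shell_sqrt_mean_ratio_le p0 metric conv le_h N dm s \<alpha> ent) auto
      also have "\<dots> \<le> ennreal (sqrt (w \<alpha> / D0)) * ennreal (sqrt (measure (\<pi> \<alpha>) ?C) * ?z)"
        using mono by (intro mult_left_mono ennreal_leI mult_right_mono) auto
      also have "\<dots> = ennreal (sqrt (w \<alpha> * measure (\<pi> \<alpha>) ?C / D0) * ?z)"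
        using w[OF \<alpha>] D0 by (simp add: real_sqrt_mult real_sqrt_divide flip: ennreal_mult)
      also have "sqrt (w \<alpha> * measure (\<pi> \<alpha>) ?C / D0) * ?z
          = sqrt (ratio \<alpha> (real (Suc (j0 + k)) * s \<alpha>)) * (exp (real n * e\<^sup>2) * ?z)"
        unfolding ratio_D0 by (simp only: real_sqrt_mult real_sqrt_abs abs_exp_cancel mult.assoc)
      also have "exp (real n * e\<^sup>2) * ?z = exp (real n * e\<^sup>2 + V \<alpha> - real n * ((2 * real (j0 + k) - 1) * s \<alpha> / 3)\<^sup>2 / 2)"
        by (simp flip: exp_add)
      finally show "(\<integral>\<^sup>+X. ennreal (sqrt (w \<alpha> / D0)) * ennreal (sqrt (enn2real (?mr \<alpha> (?Sh \<alpha> k) X))) \<partial>?Q)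
        \<le> ennreal (sqrt (ratio \<alpha> (real (Suc (j0 + k)) * s \<alpha>)) *
           exp (real n * e\<^sup>2 + V \<alpha> - real n * ((2 * real (j0 + k) - 1) * s \<alpha> / 3)\<^sup>2 / 2))" .
    qed
    finally show ?thesis .
  qed
  have "(\<integral>\<^sup>+X. posterior A w \<pi> n ?S X \<partial>?Q) \<le> (\<integral>\<^sup>+X. indicator G X + (\<integral>\<^sup>+\<alpha>. f \<alpha> X \<partial>count_space A) \<partial>?Q)"
    using AE_sample_law_pos[OF p0, of n] AE_space
    by (intro nn_integral_mono_AE) (auto elim!: eventually_elim2 intro: pointwise)
  also have "\<dots> = emeasure ?Q G + (\<integral>\<^sup>+X. \<integral>\<^sup>+\<alpha>. f \<alpha> X \<partial>count_space A \<partial>?Q)"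
    using G(1) borel_measurable_nn_integral_count_space[OF A f_m] by (subst nn_integral_add) auto
  also have "(\<integral>\<^sup>+X. \<integral>\<^sup>+\<alpha>. f \<alpha> X \<partial>count_space A \<partial>?Q) = (\<integral>\<^sup>+\<alpha>. \<integral>\<^sup>+X. f \<alpha> X \<partial>?Q \<partial>count_space A)"
    using A f_m by (rule nn_integral_count_space_nn_integral)
  also have "\<dots> \<le> (\<integral>\<^sup>+\<alpha>. ennreal (ratio \<alpha> (t \<alpha>) * exp (2 * real n * e\<^sup>2)) * indicator Cc \<alpha>
      + (\<Sum>k. ennreal (sqrt (ratio \<alpha> (real (Suc (j0 + k)) * s \<alpha>)) *
           exp (real n * e\<^sup>2 + V \<alpha> - real n * ((2 * real (j0 + k) - 1) * s \<alpha> / 3)\<^sup>2 / 2))) \<partial>count_space A)"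
    using f_int by (intro nn_integral_mono) simp
  also have "\<dots> = (\<integral>\<^sup>+\<alpha>. ennreal (ratio \<alpha> (t \<alpha>) * exp (2 * real n * e\<^sup>2)) * indicator Cc \<alpha> \<partial>count_space A)
      + (\<integral>\<^sup>+\<alpha>. (\<Sum>k. ennreal (sqrt (ratio \<alpha> (real (Suc (j0 + k)) * s \<alpha>)) *
           exp (real n * e\<^sup>2 + V \<alpha> - real n * ((2 * real (j0 + k) - 1) * s \<alpha> / 3)\<^sup>2 / 2))) \<partial>count_space A)"
    by (intro nn_integral_add) auto
  also have "(\<integral>\<^sup>+\<alpha>. ennreal (ratio \<alpha> (t \<alpha>) * exp (2 * real n * e\<^sup>2)) * indicator Cc \<alpha> \<partial>count_space A)
      = (\<integral>\<^sup>+\<alpha>. ennreal (ratio \<alpha> (t \<alpha>) * exp (2 * real n * e\<^sup>2)) \<partial>count_space Cc)"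
    using Cc by (subst (1 2) nn_integral_count_space_indicator)
      (auto intro!: nn_integral_cong simp: indicator_def)
  finally show ?thesis
    using G(2) by (simp add: add.assoc add_mono order_trans[OF _ add_right_mono])
qed

section \<open>Contraction of the posterior\<close>

lemma nn_integral_count_space_ennreal:
  fixes f :: "'i \<Rightarrow> real"
  assumes "countable A" "f summable_on A" "\<And>x. x \<in> A \<Longrightarrow> 0 \<le> f x"
  shows "(\<integral>\<^sup>+x. ennreal (f x) \<partial>count_space A) = ennreal (infsum f A)"
proof -
  have "(\<integral>\<^sup>+x. ennreal (f x) \<partial>count_space A) = (\<Sum>\<^sub>\<infinity>x\<in>A. ennreal (f x))"
    by (rule infsum_eq_nn_integral_count_space[OF assms(1), symmetric])
  also have "\<dots> = (SUP F\<in>{F. finite F \<and> F \<subseteq> A}. \<Sum>x\<in>F. ennreal (f x))"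
    by (rule nonneg_infsum_complete) simp
  also have "\<dots> = (SUP F\<in>{F. finite F \<and> F \<subseteq> A}. ennreal (sum f F))"
    using assms(3) by (intro SUP_cong refl sum_ennreal) auto
  also have "\<dots> = ennreal (infsum f A)"
    using infsum_nonneg_is_SUPREMUM_ennreal[OF assms(2,3)] by simp
  finally show ?thesis .
qed

text \<open>Here \<open>x\<close> is \<open>I * B\<close>. To leading order, entropy takes at most
  \<open>j\<^sup>2 / 25\<close>, the square root of the prior mass ratio at most
  \<open>j\<^sup>2 / 36\<close>, and the affinity gives back \<open>2 * j\<^sup>2 / 9\<close>. The
  surplus yields the constant \<open>- 3\<close> and a linear term that makes the shell bounds
  summable.\<close>

lemma shell_exponent_le:
  fixes F L x :: real and j :: nat
  assumes L: "L < 1 / 18" and F: "0 \<le> F" and x: "0 < x" "36 * (F + 1) < x\<^sup>2" and j: "x - 1 < real j"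
  shows "F + L * (real (Suc j))\<^sup>2 / 2 - ((2 * real j - 1) / 3)\<^sup>2 / 2 \<le> - 3 - real j / 100"
proof -
  have "6\<^sup>2 < x\<^sup>2" using x F by simp
  then have x6: "6 < x" by (rule power2_less_imp_less) (use x(1) in simp)
  then have j6: "6 \<le> real j" using j by simp
  \<comment> \<open>Since \<open>x > 6\<close>, subtracting 1 costs at most a sixth of
    \<open>x\<close>; this turns the constant 36 into 25.\<close>
  have "5 / 6 * x \<le> real j" using j x6 by simp
  then have "(5 / 6 * x)\<^sup>2 \<le> (real j)\<^sup>2" using x(1) by (intro power_mono) auto
  then have F_le: "F \<le> (real j)\<^sup>2 / 25 - 1" using x(2) by (simp add: power_mult_distrib power_divide)
  have L_le: "L * (real (Suc j))\<^sup>2 \<le> 1 / 18 * (real (Suc j))\<^sup>2"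
    using L by (intro mult_right_mono) auto
  define l where "l = L * (real (Suc j))\<^sup>2"
  have sq: "(real (Suc j))\<^sup>2 = (real j)\<^sup>2 + 2 * real j + 1"
    "((2 * real j - 1) / 3)\<^sup>2 = (4 * (real j)\<^sup>2 - 4 * real j + 1) / 9"
    by (simp_all add: power2_eq_square algebra_simps add_divide_distrib)
  have "6 * real j \<le> (real j)\<^sup>2" using j6 by (simp add: power2_eq_square)
  \<comment> \<open>With \<open>y\<close> for the square of \<open>j\<close> and the relation
    \<open>6 * r \<le> y\<close>, the inequality is linear.\<close>
  moreover have "F + l / 2 - (4 * y - 4 * r + 1) / 9 / 2 \<le> - 3 - r / 100"
    if "6 * r \<le> y" "F \<le> y / 25 - 1" "l \<le> 1 / 18 * (y + 2 * r + 1)" "6 \<le> r" for y r :: real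
    using that by (simp add: field_simps)
  ultimately show ?thesis
    using F_le L_le j6 unfolding l_def[symmetric] unfolding sq by blast
qed

theorem theorem2p1:
  fixes M :: "'x measure"
    and p0 :: "'x \<Rightarrow> real"
    and d :: "('x \<Rightarrow> real) \<Rightarrow> ('x \<Rightarrow> real) \<Rightarrow> real"
    and A :: "nat \<Rightarrow> 'i set"
    and w :: "nat \<Rightarrow> 'i \<Rightarrow> real"
    and \<pi> :: "nat \<Rightarrow> 'i \<Rightarrow> ('x \<Rightarrow> real) measure"
    and \<epsilon> :: "nat \<Rightarrow> 'i \<Rightarrow> real"
    and \<beta> :: "nat \<Rightarrow> 'i"
    and \<mu> :: "nat \<Rightarrow> 'i \<Rightarrow> real"
    and E :: "'i \<Rightarrow> real"
    and K B L H I E_fine E_coarse :: real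
  assumes p0: "p0 \<in> densities M"
    and d_metric: "density_metric M d"
    and d_le_hellinger: "\<And>p q. p \<in> densities M \<Longrightarrow> q \<in> densities M \<Longrightarrow> d p q \<le> hellinger M p q"
    and d_convex: "convex_balls M d"
    and A_countable: "\<And>n. n \<ge> 1 \<Longrightarrow> countable (A n)"
    and weights_nonneg: "\<And>n \<alpha>. n \<ge> 1 \<Longrightarrow> \<alpha> \<in> A n \<Longrightarrow> 0 \<le> w n \<alpha>"
    and weights_sum: "\<And>n. n \<ge> 1 \<Longrightarrow> (w n has_sum 1) (A n)"
    and priors: "\<And>n \<alpha>. n \<ge> 1 \<Longrightarrow> \<alpha> \<in> A n \<Longrightarrow> model_prior M (\<pi> n \<alpha>)"
    and d_measurable:
      "\<And>n \<alpha>. n \<ge> 1 \<Longrightarrow> \<alpha> \<in> A n \<Longrightarrow> (\<lambda>p. d p p0) \<in> borel_measurable (\<pi> n \<alpha>)"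
    and rates_pos: "\<And>n \<alpha>. n \<ge> 1 \<Longrightarrow> \<alpha> \<in> A n \<Longrightarrow> 0 < \<epsilon> n \<alpha>"
    and rates_tendsto:
      "\<And>\<alpha>. ((\<lambda>n. \<epsilon> n \<alpha>) \<longlongrightarrow> 0) (inf sequentially (principal {n. \<alpha> \<in> A n}))"
    and K: "K = 1 / 9"
    and \<beta>_in: "\<And>n. n \<ge> 1 \<Longrightarrow> \<beta> n \<in> A n"
    and \<beta>_rate: "filterlim (\<lambda>n. real n * (\<epsilon> n (\<beta> n))\<^sup>2) at_top sequentially"
    and \<beta>_weight_pos: "\<And>n. n \<ge> 1 \<Longrightarrow> 0 < w n (\<beta> n)"
    and \<beta>_mass_pos:
      "\<And>n. n \<ge> 1 \<Longrightarrow>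
         0 < measure (\<pi> n (\<beta> n)) (KL_nbhd M p0 (space (\<pi> n (\<beta> n))) (\<epsilon> n (\<beta> n)))"
    and constants: "B > 0" "L > 0" "H \<ge> 1" "I > 2"
    and E_pos: "\<And>n \<alpha>. n \<ge> 1 \<Longrightarrow> \<alpha> \<in> A n \<Longrightarrow> 0 < E \<alpha>"
    and \<mu>_nonneg: "\<And>n \<alpha>. n \<ge> 1 \<Longrightarrow> \<alpha> \<in> A n \<Longrightarrow> 0 \<le> \<mu> n \<alpha>"
    and entropy:
      "\<And>n \<alpha>. n \<ge> 1 \<Longrightarrow> \<alpha> \<in> A n \<Longrightarrow>
         (SUP \<delta>\<in>{\<epsilon> n \<alpha>..}.
            log_enat (covering_number (\<delta> / 3) (dist_nbhd d p0 (space (\<pi> n \<alpha>)) (2 * \<delta>)) d))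
         \<le> ereal (E \<alpha> * real n * (\<epsilon> n \<alpha>)\<^sup>2)"
    and mass_coarse:
      "\<And>n \<alpha> (i::nat). n \<ge> 1 \<Longrightarrow> \<alpha> \<in> coarser_models H (A n) (\<epsilon> n) (\<beta> n) \<Longrightarrow> real i \<ge> I \<Longrightarrow>
         w n \<alpha> / w n (\<beta> n) *
         (measure (\<pi> n \<alpha>) (dist_nbhd d p0 (space (\<pi> n \<alpha>)) (real i * \<epsilon> n \<alpha>)) /
          measure (\<pi> n (\<beta> n)) (KL_nbhd M p0 (space (\<pi> n (\<beta> n))) (\<epsilon> n (\<beta> n))))
         \<le> \<mu> n \<alpha> * exp (L * (real i)\<^sup>2 * real n * (\<epsilon> n \<alpha>)\<^sup>2)"
    and mass_fine:
      "\<And>n \<alpha> (i::nat). n \<ge> 1 \<Longrightarrow> \<alpha> \<in> finer_models H (A n) (\<epsilon> n) (\<beta> n) \<Longrightarrow> real i \<ge> I \<Longrightarrow>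
         w n \<alpha> / w n (\<beta> n) *
         (measure (\<pi> n \<alpha>) (dist_nbhd d p0 (space (\<pi> n \<alpha>)) (real i * \<epsilon> n (\<beta> n))) /
          measure (\<pi> n (\<beta> n)) (KL_nbhd M p0 (space (\<pi> n (\<beta> n))) (\<epsilon> n (\<beta> n))))
         \<le> \<mu> n \<alpha> * exp (L * (real i)\<^sup>2 * real n * (\<epsilon> n (\<beta> n))\<^sup>2)"
    and mass_coarse_sum:
      "(\<lambda>n. \<Sum>\<^sub>\<infinity>\<alpha>\<in>coarser_models H (A n) (\<epsilon> n) (\<beta> n).
          w n \<alpha> / w n (\<beta> n) *
          (measure (\<pi> n \<alpha>) (dist_nbhd d p0 (space (\<pi> n \<alpha>)) (I * B * \<epsilon> n \<alpha>)) /
           measure (\<pi> n (\<beta> n)) (KL_nbhd M p0 (space (\<pi> n (\<beta> n))) (\<epsilon> n (\<beta> n)))))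
       \<in> o[sequentially](\<lambda>n. exp (- 2 * real n * (\<epsilon> n (\<beta> n))\<^sup>2))"
    and E_fine:
      "\<And>n. n \<ge> 1 \<Longrightarrow>
         (SUP \<alpha>\<in>finer_models H (A n) (\<epsilon> n) (\<beta> n).
            ereal (E \<alpha> * (\<epsilon> n \<alpha>)\<^sup>2 / (\<epsilon> n (\<beta> n))\<^sup>2)) \<le> ereal E_fine"
    and E_coarse:
      "\<And>n. n \<ge> 1 \<Longrightarrow>
         (SUP \<alpha>\<in>coarser_models H (A n) (\<epsilon> n) (\<beta> n). ereal (E \<alpha>)) \<le> ereal E_coarse"
    and E_coarse_empty:
      "(\<forall>n\<ge>1. coarser_models H (A n) (\<epsilon> n) (\<beta> n) = {}) \<Longrightarrow> E_coarse = 0"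
    and B_H: "B > sqrt H"
    and B_K: "K * B\<^sup>2 > max (H * E_coarse) E_fine + 1"
    and B_I: "B\<^sup>2 * I\<^sup>2 * (K - 2 * L) > 3"
    and \<mu>_sum:
      "\<And>n. n \<ge> 1 \<Longrightarrow>
         (\<Sum>\<^sub>\<infinity>\<alpha>\<in>A n. ennreal (sqrt (\<mu> n \<alpha>))) \<le> ennreal (exp (real n * (\<epsilon> n (\<beta> n))\<^sup>2))"
  shows "((\<lambda>n. \<integral>\<^sup>+ X. posterior (A n) (w n) (\<pi> n) n {p. d p p0 \<ge> I * B * \<epsilon> n (\<beta> n)} X
              \<partial>sample_law M p0 n) \<longlongrightarrow> 0) sequentially"
proof -
  define a where "a n = real n * (\<epsilon> n (\<beta> n))\<^sup>2" for n
  \<comment> \<open>One entropy constant for all models: for coarse ones it bounds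
    \<open>E \<alpha>\<close> at their own rate, for the others it bounds the entropy expressed at
    the rate of \<open>\<beta> n\<close>.\<close>
  define F where "F = max (H * E_coarse) E_fine"
  \<comment> \<open>Shell indices are integers, as the prior mass conditions demand. Rounding
    \<open>I * B\<close> down lets the shells cover everything beyond that radius.\<close>
  define j0 where "j0 = nat \<lfloor>I * B\<rfloor>"
  define Cc where "Cc n = coarser_models H (A n) (\<epsilon> n) (\<beta> n)" for n
  define KL where "KL n = KL_nbhd M p0 (space (\<pi> n (\<beta> n))) (\<epsilon> n (\<beta> n))" for n
  define ratio where "ratio n \<alpha> u =
    w n \<alpha> / w n (\<beta> n) * (measure (\<pi> n \<alpha>) (dist_nbhd d p0 (space (\<pi> n \<alpha>)) u) / measure (\<pi> n (\<beta> n)) (KL n))" for n \<alpha> u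
  define cs where "cs n = (\<Sum>\<^sub>\<infinity>\<alpha>\<in>Cc n. ratio n \<alpha> (I * B * \<epsilon> n \<alpha>))" for n
  note not_Cc = Cc_def coarser_models_def finer_models_def

  \<comment> \<open>Numerical consequences of the conditions on the constants\<close>
  have a_lim: "filterlim a at_top sequentially" using \<beta>_rate unfolding a_def[abs_def] .
  have E_fine_pos: "0 < E_fine"
  proof -
    \<comment> \<open>As \<open>H \<ge> 1\<close>, the index \<open>\<beta> 1\<close> is among its
      own finer models, and its entry in the supremum is \<open>E (\<beta> 1) > 0\<close>.\<close>
    have "ereal (E (\<beta> 1) * (\<epsilon> 1 (\<beta> 1))\<^sup>2 / (\<epsilon> 1 (\<beta> 1))\<^sup>2) \<le> ereal E_fine"
      using E_fine[of 1] \<beta>_in[of 1] constants(3) mult_right_mono[of 1 H "(\<epsilon> 1 (\<beta> 1))\<^sup>2"]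
      by (auto simp: finer_models_def SUP_le_iff)
    then show ?thesis using E_pos[of 1 "\<beta> 1"] \<beta>_in[of 1] rates_pos[of 1 "\<beta> 1"] by simp
  qed
  then have F: "0 < F" by (simp add: F_def)
  have BF: "9 * (F + 1) < B\<^sup>2" using B_K K by (simp add: F_def)
  have "3\<^sup>2 < B\<^sup>2" using BF F by simp
  then have B3: "3 < B" by (rule power2_less_imp_less) (use constants(1) in simp)
  have IB: "6 < I * B" using mult_strict_mono[of 2 I 3 B] constants B3 by simp
  have IB2: "36 * (F + 1) < (I * B)\<^sup>2"
  proof -
    have "4 * B\<^sup>2 \<le> I\<^sup>2 * B\<^sup>2" using power_mono[of 2 I 2] constants(4) by (intro mult_right_mono) auto
    then show ?thesis using BF by (simp add: power_mult_distrib)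
  qed
  have "0 < K - 2 * L"
  proof (rule ccontr)
    assume "\<not> 0 < K - 2 * L"
    then have "B\<^sup>2 * I\<^sup>2 * (K - 2 * L) \<le> 0" by (intro mult_nonneg_nonpos) auto
    then show False using B_I by simp
  qed
  then have L18: "L < 1 / 18" using K by simp
  have j0_eq: "real j0 = of_int \<lfloor>I * B\<rfloor>" using IB by (simp add: j0_def)
  have j0: "real j0 \<le> I * B" "I * B - 1 < real j0" unfolding j0_eq by linarith+

  \<comment> \<open>The bound at a fixed sample size\<close>
  have bound: "(\<integral>\<^sup>+ X. posterior (A n) (w n) (\<pi> n) n {p. d p p0 \<ge> I * B * \<epsilon> n (\<beta> n)} X \<partial>sample_law M p0 n)
      \<le> ennreal (1 / a n + cs n * exp (2 * a n) + 2 * exp (- a n))"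
    if n: "n \<ge> 1" and an: "100 \<le> a n" for n
  proof -
    define e where "e = \<epsilon> n (\<beta> n)"
    \<comment> \<open>The shell width follows the scale of the prior mass conditions: the own rate
      of a coarse model, otherwise the rate of \<open>\<beta> n\<close>.\<close>
    define s where "s \<alpha> = (if \<alpha> \<in> Cc n then \<epsilon> n \<alpha> else e)" for \<alpha>
    define V where "V \<alpha> = F * (real n * (s \<alpha>)\<^sup>2)" for \<alpha>
    have e: "0 < e" using rates_pos[OF n \<beta>_in[OF n]] by (simp add: e_def)
    have a_eq: "a n = real n * e\<^sup>2" by (simp add: a_def e_def)
    have Cc_sub: "Cc n \<subseteq> A n" by (auto simp: not_Cc)
    have s_pos: "0 < s \<alpha>" if "\<alpha> \<in> A n" for \<alpha> using e rates_pos[OF n that] by (simp add: s_def)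
    have w_nn: "0 \<le> w n \<alpha>" if "\<alpha> \<in> A n" for \<alpha> using weights_nonneg[OF n that] .
    have He: "e\<^sup>2 \<le> H * e\<^sup>2" using constants(3) mult_right_mono[of 1 H "e\<^sup>2"] by simp
    have s_ge: "a n \<le> real n * (s \<alpha>)\<^sup>2" if "\<alpha> \<in> A n" for \<alpha>
      unfolding a_eq using He by (intro mult_left_mono) (auto simp: s_def not_Cc e_def)
    have fine: "\<alpha> \<in> finer_models H (A n) (\<epsilon> n) (\<beta> n)" if "\<alpha> \<in> A n" "\<alpha> \<notin> Cc n" for \<alpha>
      using that by (auto simp: not_Cc)
    have rate_le: "\<epsilon> n \<alpha> \<le> B * s \<alpha>" if \<alpha>: "\<alpha> \<in> A n" for \<alpha>
    proof (cases "\<alpha> \<in> Cc n")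
      case True
      then show ?thesis using rates_pos[OF n \<alpha>] B3 by (simp add: s_def)
    next
      case False
      \<comment> \<open>A model that is not coarse may still have a rate above \<open>e\<close>, by
        a factor up to \<open>sqrt H\<close>; \<open>B > sqrt H\<close> absorbs it.\<close>
      have "(\<epsilon> n \<alpha>)\<^sup>2 \<le> H * e\<^sup>2" using fine[OF \<alpha> False] by (simp add: finer_models_def e_def)
      then have "\<epsilon> n \<alpha> \<le> sqrt (H * e\<^sup>2)" by (rule real_le_rsqrt)
      also have "\<dots> = sqrt H * e" using e by (simp add: real_sqrt_mult)
      also have "\<dots> \<le> B * e" using B_H e by (intro mult_right_mono) auto
      finally show ?thesis using False by (simp add: s_def)
    qed
    have V_ge: "E \<alpha> * real n * (\<epsilon> n \<alpha>)\<^sup>2 \<le> V \<alpha>" if \<alpha>: "\<alpha> \<in> A n" for \<alpha>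
    proof (cases "\<alpha> \<in> Cc n")
      case True
      have "E \<alpha> \<le> E_coarse"
        using E_coarse[OF n] True by (auto simp: SUP_le_iff Cc_def)
      moreover have "E_coarse \<le> H * E_coarse"
        using E_pos[OF n \<alpha>] calculation constants(3) mult_right_mono[of 1 H E_coarse] by simp
      ultimately have "E \<alpha> \<le> F" by (simp add: F_def)
      then have "E \<alpha> * (real n * (\<epsilon> n \<alpha>)\<^sup>2) \<le> F * (real n * (\<epsilon> n \<alpha>)\<^sup>2)" by (intro mult_right_mono) auto
      then show ?thesis using True by (simp add: V_def s_def mult.assoc)
    next
      case False
      have F_ge: "E_fine \<le> F" by (simp add: F_def)
      have "E \<alpha> * (\<epsilon> n \<alpha>)\<^sup>2 / e\<^sup>2 \<le> E_fine"
        using E_fine[OF n] fine[OF \<alpha> False] by (auto simp: SUP_le_iff e_def)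
      then have "E \<alpha> * (\<epsilon> n \<alpha>)\<^sup>2 \<le> E_fine * e\<^sup>2" using e by (simp add: pos_divide_le_eq)
      also have "\<dots> \<le> F * e\<^sup>2" using F_ge by (rule mult_right_mono) simp
      finally have "E \<alpha> * (\<epsilon> n \<alpha>)\<^sup>2 \<le> F * e\<^sup>2" .
      then have "real n * (E \<alpha> * (\<epsilon> n \<alpha>)\<^sup>2) \<le> real n * (F * e\<^sup>2)" by (rule mult_left_mono) simp
      then show ?thesis using False by (simp add: V_def s_def mult_ac)
    qed
    have ent: "log_enat (covering_number (real (Suc j) * s \<alpha> / 6)
        (dist_nbhd d p0 (space (\<pi> n \<alpha>)) (real (Suc j) * s \<alpha>)) d) \<le> ereal (V \<alpha>)"
      if \<alpha>: "\<alpha> \<in> A n" and j: "j0 \<le> j" for \<alpha> j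
    proof -
      \<comment> \<open>Half the outer radius of the shell, so that the entropy condition concerns
        balls of radius \<open>\<delta> / 3\<close> in the neighbourhood of radius
        \<open>2 * \<delta>\<close>. \<open>I > 2\<close> makes \<open>\<delta>\<close> at least
        \<open>B * s \<alpha>\<close>, hence at least \<open>\<epsilon> n \<alpha>\<close>.\<close>
      define \<delta> where "\<delta> = real (Suc j) * s \<alpha> / 2"
      have "2 * B \<le> I * B" using constants by (intro mult_right_mono) auto
      then have "2 * B \<le> real (Suc j)" using j j0(2) by simp
      then have "2 * B * s \<alpha> \<le> real (Suc j) * s \<alpha>" using s_pos[OF \<alpha>] by (intro mult_right_mono) auto
      then have "\<epsilon> n \<alpha> \<le> \<delta>" using rate_le[OF \<alpha>] by (simp add: \<delta>_def)
      then have "log_enat (covering_number (\<delta> / 3) (dist_nbhd d p0 (space (\<pi> n \<alpha>)) (2 * \<delta>)) d)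
          \<le> ereal (E \<alpha> * real n * (\<epsilon> n \<alpha>)\<^sup>2)"
        using entropy[OF n \<alpha>] by (simp add: SUP_le_iff)
      also have "\<dots> \<le> ereal (V \<alpha>)" using V_ge[OF \<alpha>] by simp
      finally show ?thesis by (simp add: \<delta>_def)
    qed
    have ratio_nn: "0 \<le> ratio n \<alpha> u" if "\<alpha> \<in> A n" for \<alpha> u
      using w_nn[OF that] \<beta>_weight_pos[OF n] by (simp add: ratio_def)
    \<comment> \<open>\<open>measure\<close> is 0 on nonmeasurable sets, so positive mass also
      yields measurability of the neighbourhood.\<close>
    have KL: "KL n \<in> sets (\<pi> n (\<beta> n))" "0 < measure (\<pi> n (\<beta> n)) (KL n)"
      using \<beta>_mass_pos[OF n] by (auto simp: KL_def measure_notin_sets intro: ccontr)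
    have "(\<integral>\<^sup>+ X. posterior (A n) (w n) (\<pi> n) n {p. I * B * e \<le> d p p0} X \<partial>sample_law M p0 n)
      \<le> ennreal (1 / (real n * e\<^sup>2))
      + (\<integral>\<^sup>+\<alpha>. ennreal (ratio n \<alpha> (I * B * s \<alpha>) * exp (2 * real n * e\<^sup>2)) \<partial>count_space (Cc n))
      + (\<integral>\<^sup>+\<alpha>. (\<Sum>k. ennreal (sqrt (ratio n \<alpha> (real (Suc (j0 + k)) * s \<alpha>)) *
           exp (real n * e\<^sup>2 + V \<alpha> - real n * ((2 * real (j0 + k) - 1) * s \<alpha> / 3)\<^sup>2 / 2))) \<partial>count_space (A n))"
      unfolding ratio_def
    proof (rule posterior_expectation_le[where A="A n" and w="w n" and \<pi>="\<pi> n" and b="\<beta> n" and s=s and V=V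
          and B="KL n" and Cc="Cc n" and t="\<lambda>\<alpha>. I * B * s \<alpha>", OF p0 d_metric d_convex d_le_hellinger A_countable[OF n] w_nn
          priors[OF n] d_measurable[OF n] \<beta>_in[OF n] \<beta>_weight_pos[OF n] KL _ n e Cc_sub s_pos _ _ _ ent])
      show "KL n \<subseteq> KL_nbhd M p0 (space (\<pi> n (\<beta> n))) e" by (simp add: KL_def e_def)
      show "1 \<le> j0" using j0(2) IB by linarith
      show "real j0 * s \<alpha> \<le> I * B * s \<alpha>" if "\<alpha> \<in> A n" for \<alpha>
        using j0(1) s_pos[OF that] by (intro mult_right_mono) auto
      show "I * B * s \<alpha> \<le> I * B * e" if "\<alpha> \<in> A n" "\<alpha> \<notin> Cc n" for \<alpha>
        using that by (simp add: s_def)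
    qed auto
    also have "(\<integral>\<^sup>+\<alpha>. ennreal (ratio n \<alpha> (I * B * s \<alpha>) * exp (2 * real n * e\<^sup>2)) \<partial>count_space (Cc n))
        = ennreal (cs n * exp (2 * a n))"
    proof -
      \<comment> \<open>A real \<open>infsum\<close> defaults to 0 without summability. The finite
        total weight supplies it, so that \<open>cs n\<close> is the genuine sum.\<close>
      have "w n summable_on Cc n"
        using weights_sum[OF n] Cc_sub by (meson has_sum_imp_summable summable_on_subset_banach)
      then have "(\<lambda>\<alpha>. w n \<alpha> * (1 / (w n (\<beta> n) * measure (\<pi> n (\<beta> n)) (KL n)))) summable_on Cc n"
        by (rule summable_on_cmult_left)
      then have "(\<lambda>\<alpha>. ratio n \<alpha> (I * B * \<epsilon> n \<alpha>)) summable_on Cc n"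
      proof (rule summable_on_comparison_test)
        fix \<alpha> assume "\<alpha> \<in> Cc n"
        then have \<alpha>: "\<alpha> \<in> A n" using Cc_sub by auto
        interpret N: prob_space "\<pi> n \<alpha>" by (rule model_prior_prob_space[OF priors[OF n \<alpha>]])
        show "0 \<le> ratio n \<alpha> (I * B * \<epsilon> n \<alpha>)" by (rule ratio_nn[OF \<alpha>])
        have "w n \<alpha> * measure (\<pi> n \<alpha>) (dist_nbhd d p0 (space (\<pi> n \<alpha>)) (I * B * \<epsilon> n \<alpha>)) \<le> w n \<alpha> * 1"
          by (intro mult_left_mono N.prob_le_1 w_nn \<alpha>)
        then show "ratio n \<alpha> (I * B * \<epsilon> n \<alpha>) \<le> w n \<alpha> * (1 / (w n (\<beta> n) * measure (\<pi> n (\<beta> n)) (KL n)))"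
          using \<beta>_weight_pos[OF n] KL(2) by (simp add: ratio_def divide_right_mono)
      qed
      then have "(\<lambda>\<alpha>. ratio n \<alpha> (I * B * \<epsilon> n \<alpha>) * exp (2 * a n)) summable_on Cc n"
        and "(\<Sum>\<^sub>\<infinity>\<alpha>\<in>Cc n. ratio n \<alpha> (I * B * \<epsilon> n \<alpha>) * exp (2 * a n)) = cs n * exp (2 * a n)"
        unfolding cs_def by (auto intro: summable_on_cmult_left infsum_cmult_left)
      moreover have "(\<integral>\<^sup>+\<alpha>. ennreal (ratio n \<alpha> (I * B * s \<alpha>) * exp (2 * real n * e\<^sup>2)) \<partial>count_space (Cc n))
        = (\<integral>\<^sup>+\<alpha>. ennreal (ratio n \<alpha> (I * B * \<epsilon> n \<alpha>) * exp (2 * a n)) \<partial>count_space (Cc n))"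
        by (intro nn_integral_cong) (simp add: s_def a_eq mult.assoc)
      moreover have "0 \<le> ratio n \<alpha> (I * B * \<epsilon> n \<alpha>) * exp (2 * a n)" if "\<alpha> \<in> Cc n" for \<alpha>
        using that Cc_sub by (intro mult_nonneg_nonneg ratio_nn) auto
      ultimately show ?thesis
        using nn_integral_count_space_ennreal[of "Cc n" "\<lambda>\<alpha>. ratio n \<alpha> (I * B * \<epsilon> n \<alpha>) * exp (2 * a n)"]
          countable_subset[OF Cc_sub A_countable[OF n]] by simp
    qed
    also have "(\<integral>\<^sup>+\<alpha>. (\<Sum>k. ennreal (sqrt (ratio n \<alpha> (real (Suc (j0 + k)) * s \<alpha>)) *
           exp (real n * e\<^sup>2 + V \<alpha> - real n * ((2 * real (j0 + k) - 1) * s \<alpha> / 3)\<^sup>2 / 2))) \<partial>count_space (A n))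
        \<le> (\<integral>\<^sup>+\<alpha>. ennreal (sqrt (\<mu> n \<alpha>)) * ennreal (2 * exp (- 2 * a n)) \<partial>count_space (A n))"
    proof (rule nn_integral_mono)
      fix \<alpha> assume "\<alpha> \<in> space (count_space (A n))"
      then have \<alpha>: "\<alpha> \<in> A n" by simp
      define b where "b = real n * (s \<alpha>)\<^sup>2"
      have b: "a n \<le> b" unfolding b_def by (rule s_ge[OF \<alpha>])
      have \<mu>_nn: "0 \<le> \<mu> n \<alpha>" by (rule \<mu>_nonneg[OF n \<alpha>])
      have term_le: "sqrt (ratio n \<alpha> (real (Suc (j0 + k)) * s \<alpha>)) *
           exp (real n * e\<^sup>2 + V \<alpha> - real n * ((2 * real (j0 + k) - 1) * s \<alpha> / 3)\<^sup>2 / 2)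
        \<le> sqrt (\<mu> n \<alpha>) * exp (- 2 * a n) * (1 / 2) ^ k" for k
      proof -
        define j where "j = j0 + k"
        have jx: "I * B - 1 < real j" using j0(2) by (simp add: j_def)
        have "I * 1 \<le> I * B" using constants B3 by (intro mult_left_mono) auto
        \<comment> \<open>The prior mass conditions are applied at the integer \<open>j + 1\<close>,
          the outer radius of the shell in units of \<open>s \<alpha>\<close>.\<close>
        then have Ij: "I \<le> real (Suc j)" using jx by simp
        have "ratio n \<alpha> (real (Suc j) * s \<alpha>) \<le> \<mu> n \<alpha> * exp (L * (real (Suc j))\<^sup>2 * b)"
        proof (cases "\<alpha> \<in> Cc n")
          case True
          then show ?thesis
            using mass_coarse[OF n True[unfolded Cc_def] Ij] by (simp add: ratio_def KL_def s_def b_def mult.assoc)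
        next
          case False
          then show ?thesis
            using mass_fine[OF n fine[OF \<alpha> False] Ij] by (simp add: ratio_def KL_def s_def b_def e_def mult.assoc)
        qed
        then have "sqrt (ratio n \<alpha> (real (Suc j) * s \<alpha>)) \<le> sqrt (\<mu> n \<alpha> * exp (L * (real (Suc j))\<^sup>2 * b))"
          by (rule real_sqrt_le_mono)
        also have "\<dots> = sqrt (\<mu> n \<alpha>) * exp (L * (real (Suc j))\<^sup>2 * b / 2)"
        proof -
          have "sqrt (exp z) = exp (z / 2)" for z :: real
            by (rule real_sqrt_unique) (simp_all flip: exp_double)
          then show ?thesis by (simp add: real_sqrt_mult)
        qed
        finally have sq: "sqrt (ratio n \<alpha> (real (Suc j) * s \<alpha>)) \<le> sqrt (\<mu> n \<alpha>) * exp (L * (real (Suc j))\<^sup>2 * b / 2)" .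
        have "(F + L * (real (Suc j))\<^sup>2 / 2 - ((2 * real j - 1) / 3)\<^sup>2 / 2) * b \<le> (- 3 - real j / 100) * b"
          using b an shell_exponent_le[OF L18 _ _ IB2 jx] F IB by (intro mult_right_mono) auto
        also have "\<dots> = (3 + real j / 100) * (- b)" by (simp add: algebra_simps)
        \<comment> \<open>The coefficient is positive, so the model-dependent \<open>b\<close> may
          be lowered to \<open>a n\<close>.\<close>
        also have "\<dots> \<le> (3 + real j / 100) * (- a n)" using b by (intro mult_left_mono) auto
        \<comment> \<open>This is where \<open>a n \<ge> 100\<close> enters: it turns
          \<open>j / 100\<close> into \<open>j\<close>, giving a geometric series over the
          shells.\<close>
        also have "\<dots> \<le> - 3 * a n - real j"
          using an mult_left_mono[of 100 "a n" "real j"] by (simp add: algebra_simps)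
        also have "\<dots> \<le> - 3 * a n - real k" by (simp add: j_def)
        finally have expo: "(F + L * (real (Suc j))\<^sup>2 / 2 - ((2 * real j - 1) / 3)\<^sup>2 / 2) * b \<le> - 3 * a n - real k" .
        have half: "exp (- real k) \<le> (1 / 2) ^ k"
        proof -
          have "exp (- 1 :: real) \<le> 1 / 2"
            using exp_ge_add_one_self[of 1] by (simp add: exp_minus field_simps)
          then have "exp (- 1 :: real) ^ k \<le> (1 / 2) ^ k" by (intro power_mono) auto
          then show ?thesis by (simp flip: exp_of_nat_mult)
        qed
        have "sqrt (ratio n \<alpha> (real (Suc j) * s \<alpha>)) *
            exp (real n * e\<^sup>2 + V \<alpha> - real n * ((2 * real j - 1) * s \<alpha> / 3)\<^sup>2 / 2)
          \<le> sqrt (\<mu> n \<alpha>) * exp (L * (real (Suc j))\<^sup>2 * b / 2) *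
            exp (real n * e\<^sup>2 + V \<alpha> - real n * ((2 * real j - 1) * s \<alpha> / 3)\<^sup>2 / 2)"
          by (intro mult_right_mono sq) simp
        also have "\<dots> = sqrt (\<mu> n \<alpha>) *
            exp (a n + (F + L * (real (Suc j))\<^sup>2 / 2 - ((2 * real j - 1) / 3)\<^sup>2 / 2) * b)"
        proof -
          have "real n * ((2 * real j - 1) * s \<alpha> / 3)\<^sup>2 / 2 = ((2 * real j - 1) / 3)\<^sup>2 / 2 * b"
            by (simp add: b_def power_mult_distrib power_divide)
          moreover have "V \<alpha> = F * b" by (simp add: V_def b_def)
          ultimately show ?thesis
            by (simp only: a_eq mult.assoc exp_add[symmetric]) (simp add: algebra_simps)
        qed
        \<comment> \<open>One \<open>a n\<close> of the three is spent on the evidence; the sum over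
          models below spends a second.\<close>
        also have "\<dots> \<le> sqrt (\<mu> n \<alpha>) * exp (- 2 * a n - real k)"
          using expo \<mu>_nn by (intro mult_left_mono) auto
        also have "\<dots> = sqrt (\<mu> n \<alpha>) * exp (- 2 * a n) * exp (- real k)"
          by (simp flip: exp_add)
        also have "\<dots> \<le> sqrt (\<mu> n \<alpha>) * exp (- 2 * a n) * (1 / 2) ^ k"
          using half \<mu>_nn by (intro mult_left_mono) auto
        finally show ?thesis unfolding j_def .
      qed
      have "(\<lambda>k. (1 / 2) ^ k :: real) sums 2" using geometric_sums[of "1 / 2 :: real"] by simp
      then have sums: "(\<lambda>k. sqrt (\<mu> n \<alpha>) * exp (- 2 * a n) * (1 / 2) ^ k) sums (sqrt (\<mu> n \<alpha>) * exp (- 2 * a n) * 2)"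
        by (rule sums_mult)
      have "(\<Sum>k. ennreal (sqrt (ratio n \<alpha> (real (Suc (j0 + k)) * s \<alpha>)) *
           exp (real n * e\<^sup>2 + V \<alpha> - real n * ((2 * real (j0 + k) - 1) * s \<alpha> / 3)\<^sup>2 / 2)))
        \<le> (\<Sum>k. ennreal (sqrt (\<mu> n \<alpha>) * exp (- 2 * a n) * (1 / 2) ^ k))"
        by (intro suminf_le summableI ennreal_leI term_le)
      also have "\<dots> = ennreal (sqrt (\<mu> n \<alpha>) * exp (- 2 * a n) * 2)"
        using sums \<mu>_nn by (intro suminf_ennreal_eq) auto
      also have "\<dots> = ennreal (sqrt (\<mu> n \<alpha>)) * ennreal (2 * exp (- 2 * a n))"
        using \<mu>_nn by (simp add: mult_ac flip: ennreal_mult)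
      finally show "(\<Sum>k. ennreal (sqrt (ratio n \<alpha> (real (Suc (j0 + k)) * s \<alpha>)) *
           exp (real n * e\<^sup>2 + V \<alpha> - real n * ((2 * real (j0 + k) - 1) * s \<alpha> / 3)\<^sup>2 / 2)))
        \<le> ennreal (sqrt (\<mu> n \<alpha>)) * ennreal (2 * exp (- 2 * a n))" .
    qed
    also have "\<dots> = (\<Sum>\<^sub>\<infinity>\<alpha>\<in>A n. ennreal (sqrt (\<mu> n \<alpha>))) * ennreal (2 * exp (- 2 * a n))"
      by (simp add: nn_integral_multc infsum_eq_nn_integral_count_space[OF A_countable[OF n]])
    also have "\<dots> \<le> ennreal (exp (a n)) * ennreal (2 * exp (- 2 * a n))"
      using \<mu>_sum[OF n] by (intro mult_right_mono) (auto simp: a_def)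
    also have "\<dots> = ennreal (2 * exp (- a n))"
      by (simp flip: ennreal_mult exp_add)
    also have "ennreal (1 / (real n * e\<^sup>2)) + ennreal (cs n * exp (2 * a n)) + ennreal (2 * exp (- a n))
        = ennreal (1 / a n + cs n * exp (2 * a n) + 2 * exp (- a n))"
    proof -
      have "0 \<le> cs n" unfolding cs_def using ratio_nn Cc_sub by (intro infsum_nonneg) auto
      then show ?thesis using an by (simp add: a_eq flip: ennreal_plus)
    qed
    finally show ?thesis by (simp add: e_def add_left_mono)
  qed

  \<comment> \<open>Passage to the limit\<close>
  have "(\<lambda>n. cs n / exp (- 2 * real n * (\<epsilon> n (\<beta> n))\<^sup>2)) \<longlonglongrightarrow> 0"
    using mass_coarse_sum unfolding cs_def ratio_def KL_def Cc_def by (rule smalloD_tendsto)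
  moreover have "cs n / exp (- 2 * real n * (\<epsilon> n (\<beta> n))\<^sup>2) = cs n * exp (2 * a n)" for n
    by (simp add: a_def exp_minus divide_inverse mult.assoc)
  ultimately have "(\<lambda>n. cs n * exp (2 * a n)) \<longlonglongrightarrow> 0" by simp
  moreover have "(\<lambda>n. 1 / a n) \<longlonglongrightarrow> 0"
    using a_lim by (intro tendsto_divide_0[OF tendsto_const] filterlim_at_top_imp_at_infinity)
  moreover have "(\<lambda>n. exp (- a n)) \<longlonglongrightarrow> 0"
    using a_lim by (intro filterlim_compose[OF exp_at_bot]) (simp add: filterlim_uminus_at_bot)
  ultimately have "(\<lambda>n. 1 / a n + cs n * exp (2 * a n) + 2 * exp (- a n)) \<longlonglongrightarrow> 0 + 0 + 2 * 0"
    by (intro tendsto_intros)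
  then have lim: "(\<lambda>n. ennreal (1 / a n + cs n * exp (2 * a n) + 2 * exp (- a n))) \<longlonglongrightarrow> 0"
    using tendsto_ennrealI by fastforce
  have "eventually (\<lambda>n. 100 \<le> a n) sequentially"
    using a_lim unfolding filterlim_at_top by blast
  then have "eventually (\<lambda>n. (\<integral>\<^sup>+ X. posterior (A n) (w n) (\<pi> n) n {p. d p p0 \<ge> I * B * \<epsilon> n (\<beta> n)} X \<partial>sample_law M p0 n)
      \<le> ennreal (1 / a n + cs n * exp (2 * a n) + 2 * exp (- a n))) sequentially"
    using eventually_ge_at_top[of 1] by eventually_elim (rule bound)
  then show ?thesis
    by (intro tendsto_sandwich[OF _ _ tendsto_const lim]) auto
qed

end
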